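(* (3-degree modular equation for the first derivative of the Rogers–Ramanujan continued fraction.) Let $q\in(0,1)$ and put $u=N(q)$ and $v=N(q^{3})$. Then $$125u^{12}+u^{3}v^{3}+1125u^{9}v^{3}+1125u^{3}v^{9}+1953125u^{9}v^{9}-125v^{12}=0.$$
   Context: Let $f(-q)=\prod_{n=1}^{\infty}(1-q^{n})$. Let $R(q)=q^{1/5}\prod_{n=0}^{\infty}\frac{(1-q^{5n+1})(1-q^{5n+4})}{(1-q^{5n+2})(1-q^{5n+3})}$ be the Rogers–Ramanujan continued fraction, for $0<q<1$. Define $$N(q)=q^{5/6}f(-q)^{-4}\,\frac{R'(q)}{R(q)}=q^{-1/6}f(-q)^{-4}\left(\frac15-\sum_{n=1}^{\infty}q^{n}\sum_{d\mid n}X(d)\,d\right),$$ where $R'=dR/dq$ and $X(d)=\left(\frac{d}{5}\right)$ is the Legendre symbol modulo 5. *)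

theory Defs
  imports "HOL-Analysis.Analysis"
begin

(* The value at x = -q is f(-q) = (1 - q) (1 - q^2) (1 - q^3) ... *)
definition ramanujan_f :: "real \<Rightarrow> real" where
  "ramanujan_f x = (\<Prod>n. 1 - (- x) ^ Suc n)"

definition rogers_ramanujan_cf :: "real \<Rightarrow> real" where
  "rogers_ramanujan_cf q =
     q powr (1 / 5) *
     (\<Prod>n. ((1 - q ^ (5 * n + 1)) * (1 - q ^ (5 * n + 4))) /
           ((1 - q ^ (5 * n + 2)) * (1 - q ^ (5 * n + 3))))"

definition rr_N :: "real \<Rightarrow> real" where
  "rr_N q = q powr (5 / 6) * ramanujan_f (- q) powi (- 4) *
            (deriv rogers_ramanujan_cf q / rogers_ramanujan_cf q)"

end

(*
  Put u = R(q), v = R(q^3), and let P = q^(-1/6) f(-q) / f(-q^5), Q = P(q^3).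

  Jacobi's triple product shows that theta(xy) theta(x/y) / x is a skew form of rank 2 in (x, y), so
  that it satisfies a Pluecker relation. Its instances at (q^2, q, 1, omega) in base q^5, with omega a
  primitive cube root of unity, and at (q^6, q^3, 1, q^5) in base q^15 give product formulas for
  v - u^3 and 1 + u v^3, hence (v - u^3)(1 + u v^3) = 3 u^2 v^2. A second order limit of the relation
  at the fifth roots of unity gives 5 q R'/R = f(-q)^5 / f(-q^5), so that 5 N(q) = P.

  Differentiating the equation between u and v shows that (1/u^5 - 11 - u^5) / P^6 takes the same value
  at q and at q^3. It is therefore equal to its limit 1 at q = 0. Now P^6 and Q^6 are rational functions
  on the curve of (u, v), on which (Q/P)^6 is a square, and the theorem is an identity on this curve. The
  sign of (Q/P)^3 is fixed by Q > P > 0.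
*)

theory Submission
  imports Defs "HOL-Real_Asymp.Real_Asymp"
begin

section \<open>Infinite products and theta functions\<close>

text \<open>The theorem compares derivatives of R at q and q^3, and theta functions alone supply
  everything, without modular form theory. The two factors v - u^3 and 1 + u v^3 carry more than
  their product. Each is a theta quotient times a power of f(-q^15)/f(-q^5). In the product this
  power cancels, which leaves an equation in u and v only. In the quotient it survives, and it gives
  the ratio of the values of q f(-q^5)^5/f(-q) at q^3 and q. The derivative of the product equation
  gives the corresponding ratio for f(-q)^5/f(-q^5). As P^6 is the quotient of these two functions,
  its behaviour under q -> q^3 is known algebraically in u and v, and Ramanujan's formula for 1/R^5
  - 11 - R^5 needs only a limit at 0 instead of a separate dissection argument.

  The theorem contains odd powers of (PQ)^3, while the curve determines only sixth powers of P and
  Q; this is why a square root on the curve and a choice of sign are needed.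

  Roots of unity force complex arguments, while the derivative and the fractional powers of q are
  real. The product lemmas are therefore stated over general normed fields and transferred.\<close>

definition qpoch :: "'a::{real_normed_field,banach} \<Rightarrow> 'a \<Rightarrow> 'a" where
  "qpoch z p = (\<Prod>n. 1 - z * p ^ n)"

text \<open>The modified theta function, normalised without the factor \<open>qpoch p p\<close> of
  the triple product. Its zeros are the integral powers of \<open>p\<close>.\<close>

definition jtheta :: "'a::{real_normed_field,banach} \<Rightarrow> 'a \<Rightarrow> 'a" where
  "jtheta z p = qpoch z p * qpoch (p / z) p"

lemma convergent_prod_qpoch:
  fixes z p :: "'a::{real_normed_field,banach}"
  assumes "norm p < 1"
  shows "convergent_prod (\<lambda>n. 1 - z * p ^ n)"
proof -
  have "summable (\<lambda>n. norm z * norm p ^ n)"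
    using assms by (intro summable_mult summable_geometric) auto
  hence "abs_convergent_prod (\<lambda>n. 1 - z * p ^ n)"
    by (intro summable_imp_abs_convergent_prod) (simp add: norm_mult norm_power)
  thus ?thesis by (rule abs_convergent_prod_imp_convergent_prod)
qed

lemma has_prod_qpoch:
  fixes z p :: "'a::{real_normed_field,banach}"
  assumes "norm p < 1"
  shows "(\<lambda>n. 1 - z * p ^ n) has_prod qpoch z p"
  using convergent_prod_qpoch[OF assms] unfolding qpoch_def by (rule convergent_prod_has_prod)

lemma qpoch_LIMSEQ:
  fixes z p :: "'a::{real_normed_field,banach}"
  assumes "norm p < 1"
  shows "(\<lambda>N. \<Prod>n<N. 1 - z * p ^ n) \<longlonglongrightarrow> qpoch z p"
  using has_prod_imp_tendsto'[OF has_prod_qpoch[OF assms]] .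

lemma qpoch_eq_0_iff:
  fixes z p :: "'a::{real_normed_field,banach}"
  assumes "norm p < 1"
  shows "qpoch z p = 0 \<longleftrightarrow> (\<exists>n. z * p ^ n = 1)"
proof -
  have "qpoch z p = 0 \<longleftrightarrow> 0 \<in> range (\<lambda>n. 1 - z * p ^ n)"
    by (rule has_prod_eq_0_iff[OF has_prod_qpoch[OF assms]])
  also have "\<dots> \<longleftrightarrow> (\<exists>n. z * p ^ n = 1)"
    by (metis (no_types, lifting) rangeE rangeI right_minus_eq)
  finally show ?thesis .
qed

lemma qpoch_self_nonzero:
  fixes p :: "'a::{real_normed_field,banach}"
  assumes "norm p < 1"
  shows "qpoch p p \<noteq> 0"
proof -
  have "p * p ^ n \<noteq> 1" for n
  proof
    assume "p * p ^ n = 1"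
    hence "norm p ^ Suc n = 1" by (metis norm_one norm_power power_Suc)
    moreover have "norm p ^ Suc n < 1" using assms by (simp add: power_less_one_iff del: power_Suc)
    ultimately show False by simp
  qed
  thus ?thesis by (simp add: qpoch_eq_0_iff[OF assms])
qed

lemma qpoch_head:
  fixes z p :: "'a::{real_normed_field,banach}"
  assumes "norm p < 1"
  shows "qpoch z p = (1 - z) * qpoch (z * p) p"
proof -
  have "(\<lambda>N. \<Prod>n<Suc N. 1 - z * p ^ n) \<longlonglongrightarrow> qpoch z p"
    using qpoch_LIMSEQ[OF assms] by (rule LIMSEQ_Suc)
  hence "(\<lambda>N. (1 - z) * (\<Prod>n<N. 1 - (z * p) * p ^ n)) \<longlonglongrightarrow> qpoch z p"
    by (simp add: prod.lessThan_Suc_shift algebra_simps del: prod.lessThan_Suc)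
  moreover have "(\<lambda>N. (1 - z) * (\<Prod>n<N. 1 - (z * p) * p ^ n)) \<longlonglongrightarrow> (1 - z) * qpoch (z * p) p"
    by (intro tendsto_intros qpoch_LIMSEQ assms)
  ultimately show ?thesis by (rule LIMSEQ_unique)
qed

text \<open>The factors are sorted by the residue of the exponent modulo \<open>k\<close>. Partial
  products of length \<open>N * k\<close> make the rearrangement a finite one.\<close>

lemma qpoch_multisect:
  fixes z p :: "'a::{real_normed_field,banach}"
  assumes "norm p < 1" "k > 0"
  shows "qpoch z p = (\<Prod>j<k. qpoch (z * p ^ j) (p ^ k))"
proof -
  have pk: "norm (p ^ k) < 1"
    using assms by (simp add: norm_power power_less_one_iff)
  have "(\<lambda>N. \<Prod>n<N * k. 1 - z * p ^ n) \<longlonglongrightarrow> qpoch z p"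
    by (rule LIMSEQ_subseq_LIMSEQ[OF qpoch_LIMSEQ[OF assms(1)], unfolded o_def])
       (use assms in \<open>auto simp: strict_mono_def\<close>)
  moreover have "(\<Prod>n<N * k. 1 - z * p ^ n) = (\<Prod>j<k. \<Prod>n<N. 1 - (z * p ^ j) * (p ^ k) ^ n)" for N
  proof -
    have "(\<Prod>n<N * k. 1 - z * p ^ n) = (\<Prod>n<N. \<Prod>j<k. 1 - z * p ^ (j + n * k))"
    proof (induction N)
      case (Suc N)
      have split: "(\<Prod>n<M + l. f n) = (\<Prod>n<M. f n) * (\<Prod>j<l. f (M + j))"
        for M l and f :: "nat \<Rightarrow> 'a"
        by (induction l) (simp_all add: mult.assoc)
      have "(\<Prod>n<Suc N * k. 1 - z * p ^ n) = (\<Prod>n<N * k + k. 1 - z * p ^ n)"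
        by (simp add: add.commute)
      also have "\<dots> = (\<Prod>n<N * k. 1 - z * p ^ n) * (\<Prod>j<k. 1 - z * p ^ (N * k + j))"
        by (rule split)
      finally show ?case using Suc by (simp add: add.commute)
    qed simp
    also have "\<dots> = (\<Prod>n<N. \<Prod>j<k. 1 - (z * p ^ j) * (p ^ k) ^ n)"
      by (simp add: power_add mult.assoc mult.commute[of _ k] flip: power_mult)
    also have "\<dots> = (\<Prod>j<k. \<Prod>n<N. 1 - (z * p ^ j) * (p ^ k) ^ n)"
      by (rule prod.swap)
    finally show ?thesis .
  qed
  moreover have "(\<lambda>N. \<Prod>j<k. \<Prod>n<N. 1 - (z * p ^ j) * (p ^ k) ^ n) \<longlonglongrightarrow> (\<Prod>j<k. qpoch (z * p ^ j) (p ^ k))"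
    by (intro tendsto_prod qpoch_LIMSEQ pk)
  ultimately show ?thesis by (simp add: LIMSEQ_unique)
qed

text \<open>The real identities between theta products are read off from complex ones through this
  embedding.\<close>

lemma of_real_qpoch:
  assumes "\<bar>p\<bar> < 1"
  shows "(of_real (qpoch z p) :: 'a::{real_normed_field,banach}) = qpoch (of_real z) (of_real p)"
proof -
  have "(\<lambda>n. of_real (1 - z * p ^ n) :: 'a) has_prod of_real (qpoch z p)"
    using has_prod_qpoch[of p z] assms by (subst has_prod_of_real_iff) auto
  hence "(\<lambda>n. 1 - of_real z * of_real p ^ n :: 'a) has_prod of_real (qpoch z p)"
    by simp
  thus ?thesis using has_prod_qpoch[of "of_real p :: 'a" "of_real z"] assms
    by (metis has_prod_unique norm_of_real)
qed

lemma of_real_jtheta: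
  assumes "\<bar>p\<bar> < 1"
  shows "(of_real (jtheta z p) :: 'a::{real_normed_field,banach}) = jtheta (of_real z) (of_real p)"
  by (simp add: jtheta_def of_real_qpoch[OF assms])

lemma jtheta_inverse:
  fixes z p :: "'a::{real_normed_field,banach}"
  assumes "norm p < 1" "z \<noteq> 0"
  shows "jtheta (1 / z) p = - jtheta z p / z"
proof -
  have "jtheta (1 / z) p = (1 - 1 / z) * qpoch (p / z) p * qpoch (z * p) p"
    using qpoch_head[OF assms(1), of "1 / z"] by (simp add: jtheta_def mult.commute)
  also have "\<dots> = - ((1 - z) * qpoch (z * p) p * qpoch (p / z) p) / z"
    using assms by (simp add: field_simps)
  also have "\<dots> = - jtheta z p / z"
    using qpoch_head[OF assms(1), of z] by (simp add: jtheta_def)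
  finally show ?thesis .
qed

lemma jtheta_reflect:
  assumes "p \<noteq> 0"
  shows "jtheta (p / z) p = jtheta z p"
  using assms by (simp add: jtheta_def mult.commute)

lemma jtheta_shift:
  fixes z p :: "'a::{real_normed_field,banach}"
  assumes "norm p < 1" "z \<noteq> 0" "p \<noteq> 0"
  shows "jtheta (p * z) p = - jtheta z p / z"
  using jtheta_inverse[OF assms(1,2)] jtheta_reflect[of p "1 / z"] assms by simp

section \<open>Jacobi's triple product\<close>

text \<open>A natural number, so that \<open>p ^ tri n\<close> is an ordinary power for negative
  \<open>n\<close> as well.\<close>

definition tri :: "int \<Rightarrow> nat" where
  "tri n = nat (n * (n - 1) div 2)"

lemma tri_eq: "2 * int (tri n) = n * (n - 1)"
proof -
  have "even (n * (n - 1))" by simp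
  moreover have "n * (n - 1) \<ge> 0"
    by (cases "n \<ge> 1") (auto intro: mult_nonpos_nonpos)
  ultimately show ?thesis by (simp add: tri_def)
qed

lemma int_tri_add1: "int (tri (n + 1)) = int (tri n) + n"
  using tri_eq[of n] tri_eq[of "n + 1"] by (simp add: algebra_simps)

lemma tri_0 [simp]: "tri 0 = 0" by (simp add: tri_def)

lemma tri_add1: "n \<ge> 0 \<Longrightarrow> tri (n + 1) = tri n + nat n"
  using int_tri_add1[of n] by simp

lemma tri_reflect: "tri (1 - n) = tri n"
  by (simp add: tri_def algebra_simps)

lemma summable_theta_nat:
  fixes z p :: real
  assumes "\<bar>p\<bar> < 1"
  shows "summable (\<lambda>n::nat. \<bar>z\<bar> ^ n * \<bar>p\<bar> ^ tri (int n))"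
proof -
  have "(\<lambda>n. \<bar>z\<bar> * \<bar>p\<bar> ^ n) \<longlonglongrightarrow> \<bar>z\<bar> * 0"
    using assms by (intro tendsto_intros LIMSEQ_power_zero) auto
  hence "eventually (\<lambda>n. \<bar>z\<bar> * \<bar>p\<bar> ^ n < 1 / 2) sequentially"
    by (rule order_tendstoD) auto
  then obtain N where N: "\<And>n. n \<ge> N \<Longrightarrow> \<bar>z\<bar> * \<bar>p\<bar> ^ n < 1 / 2"
    by (auto simp: eventually_at_top_linorder)
  show ?thesis
  proof (rule summable_ratio_test[where c = "1/2" and N = N])
    fix n assume "n \<ge> N"
    have "\<bar>z\<bar> ^ Suc n * \<bar>p\<bar> ^ tri (int (Suc n)) = (\<bar>z\<bar> * \<bar>p\<bar> ^ n) * (\<bar>z\<bar> ^ n * \<bar>p\<bar> ^ tri (int n))"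
      using tri_add1[of "int n"] by (simp add: power_add add.commute mult_ac)
    also have "\<dots> \<le> 1 / 2 * (\<bar>z\<bar> ^ n * \<bar>p\<bar> ^ tri (int n))"
      using N[OF \<open>n \<ge> N\<close>] by (intro mult_right_mono) auto
    finally show "norm (\<bar>z\<bar> ^ Suc n * \<bar>p\<bar> ^ tri (int (Suc n))) \<le> 1 / 2 * norm (\<bar>z\<bar> ^ n * \<bar>p\<bar> ^ tri (int n))"
      by (simp add: abs_mult power_abs)
  qed auto
qed

lemma summable_on_int_halves:
  fixes f :: "int \<Rightarrow> real"
  assumes "summable (\<lambda>n. f (int n))" "summable (\<lambda>n. f (- int n))" "\<And>n. f n \<ge> 0"
  shows "f summable_on UNIV"
proof -
  have "(\<lambda>n. f (int n)) summable_on UNIV" "(\<lambda>n. f (- int n)) summable_on UNIV"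
    using assms by (auto intro!: summable_nonneg_imp_summable_on)
  hence "f summable_on range int" "f summable_on range (\<lambda>n. - int n)"
    by (simp_all add: summable_on_reindex inj_on_def o_def)
  hence "f summable_on (range int \<union> range (\<lambda>n. - int n))"
    by (rule summable_on_union)
  moreover have "range int \<union> range (\<lambda>n. - int n) = UNIV"
  proof -
    have "x \<in> range int \<union> range (\<lambda>n. - int n)" for x
      by (cases x rule: int_cases2) auto
    thus ?thesis by auto
  qed
  ultimately show ?thesis by simp
qed

text \<open>The reflection \<open>tri (1 - n) = tri n\<close> turns the negative half of the series
  into the positive half with \<open>p / z\<close> in place of \<open>z\<close>.\<close>

lemma abs_summable_theta:
  fixes z p :: complex
  assumes "norm p < 1" "z \<noteq> 0"
  shows "(\<lambda>n. norm (z powi n * p ^ tri n)) summable_on (UNIV :: int set)"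
proof (rule summable_on_int_halves)
  show "summable (\<lambda>n. norm (z powi int n * p ^ tri (int n)))"
    using summable_theta_nat[of "norm p" "norm z"] assms by (simp add: norm_mult norm_power)
  have "norm (z powi (- int n) * p ^ tri (- int n))
      = \<bar>norm p / norm z\<bar> ^ n * \<bar>norm p\<bar> ^ tri (int n)" for n
  proof -
    have "tri (- int n) = n + tri (int n)"
      using tri_reflect[of "- int n"] tri_add1[of "int n"] by (simp add: add.commute)
    thus ?thesis
      using assms by (simp add: norm_mult norm_power power_int_minus norm_inverse norm_divide power_add field_simps)
  qed
  thus "summable (\<lambda>n. norm (z powi (- int n) * p ^ tri (- int n)))"
    using summable_theta_nat[of "norm p" "norm p / norm z"] assms by simp
qed auto

definition theta_series :: "complex \<Rightarrow> complex \<Rightarrow> complex" where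
  "theta_series z p = (\<Sum>\<^sub>\<infinity>n::int. z powi n * p ^ tri n)"

lemma has_sum_theta_series:
  assumes "norm p < 1" "z \<noteq> 0"
  shows "((\<lambda>n. z powi n * p ^ tri n) has_sum theta_series z p) UNIV"
  unfolding theta_series_def
  by (rule has_sum_infsum, rule abs_summable_summable, rule abs_summable_theta[OF assms])

text \<open>Coefficients of the Jacobi product cut off after \<open>N\<close> factors, in the basis
  \<open>z powi n * p ^ tri n\<close>. The recursion is multiplication by the next factor (1 + z
  p^N)(1 + p^(N+1)/z) = 1 + p^(2N+1) + z p^N + p^(N+1)/z.\<close>

primrec tcoeff :: "complex \<Rightarrow> nat \<Rightarrow> int \<Rightarrow> complex" where
  "tcoeff p 0 n = (if n = 0 then 1 else 0)"
| "tcoeff p (Suc N) n = (1 + p ^ (2 * N + 1)) * tcoeff p N n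
     + p powi (int N - n + 1) * tcoeff p N (n - 1) + p powi (int N + 1 + n) * tcoeff p N (n + 1)"

lemma powi_tri_add1:
  fixes p :: complex
  assumes "p \<noteq> 0"
  shows "p ^ tri (n + 1) = p ^ tri n * p powi n"
  using assms int_tri_add1[of n] by (metis power_int_add power_int_of_nat)

text \<open>Summing over all integers, although almost all coefficients vanish, makes the shifts by
  \<open>z\<close> and \<open>1 / z\<close> plain reindexings without boundary terms.\<close>

lemma finite_triple_product:
  fixes p z :: complex
  assumes "p \<noteq> 0" "z \<noteq> 0"
  shows "((\<lambda>n. tcoeff p N n * (z powi n * p ^ tri n)) has_sum
           (\<Prod>k<N. (1 + z * p ^ k) * (1 + p ^ Suc k / z))) UNIV"
proof (induction N)
  case 0
  show ?case
    by (rule has_sum_finite_neutralI[where B = "{0}"]) auto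
next
  case (Suc N)
  define A where "A = (\<Prod>k<N. (1 + z * p ^ k) * (1 + p ^ Suc k / z))"
  define t where "t = (\<lambda>n. tcoeff p N n * (z powi n * p ^ tri n))"
  have A: "(t has_sum A) UNIV" using Suc by (simp add: A_def t_def)
  have "((\<lambda>n. t (n - 1)) has_sum A) UNIV"
    using A by (subst has_sum_reindex_bij_witness[where i = "\<lambda>n. n + 1" and j = "\<lambda>n. n - 1"]) auto
  moreover have "((\<lambda>n. t (n + 1)) has_sum A) UNIV"
    using A by (subst has_sum_reindex_bij_witness[where i = "\<lambda>n. n - 1" and j = "\<lambda>n. n + 1"]) auto
  ultimately have "((\<lambda>n. (1 + p ^ (2 * N + 1)) * t n + z * p ^ N * t (n - 1) + p ^ Suc N / z * t (n + 1)) has_sum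
     ((1 + p ^ (2 * N + 1)) * A + z * p ^ N * A + p ^ Suc N / z * A)) UNIV"
    by (intro has_sum_add has_sum_cmult_right A)
  also have "(\<lambda>n. (1 + p ^ (2 * N + 1)) * t n + z * p ^ N * t (n - 1) + p ^ Suc N / z * t (n + 1))
       = (\<lambda>n. tcoeff p (Suc N) n * (z powi n * p ^ tri n))"
  proof
    fix n
    have 1: "p ^ N * p ^ tri (n - 1) = p powi (int N - n + 1) * p ^ tri n"
    proof -
      have "p ^ tri n = p ^ tri (n - 1) * p powi (n - 1)"
        using powi_tri_add1[OF assms(1), of "n - 1"] by simp
      moreover have "p powi (int N - n + 1) * p powi (n - 1) = p ^ N"
        using assms by (simp flip: power_int_add)
      ultimately show ?thesis by (simp add: mult_ac)
    qed
    have 2: "p ^ Suc N * p ^ tri (n + 1) = p powi (int N + 1 + n) * p ^ tri n"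
    proof -
      have "p powi (int N + 1 + n) = p ^ Suc N * p powi n"
        using assms by (simp add: power_int_add)
      thus ?thesis using powi_tri_add1[OF assms(1), of n] by (simp add: mult_ac)
    qed
    have 3: "z * z powi (n - 1) = z powi n" "z powi (n + 1) / z = z powi n"
      using assms by (simp_all add: power_int_diff power_int_add)
    have "z * p ^ N * t (n - 1) = tcoeff p N (n - 1) * (z * z powi (n - 1)) * (p ^ N * p ^ tri (n - 1))"
      by (simp add: t_def mult_ac)
    moreover have "p ^ Suc N / z * t (n + 1) = tcoeff p N (n + 1) * (z powi (n + 1) / z) * (p ^ Suc N * p ^ tri (n + 1))"
      by (simp add: t_def mult_ac)
    ultimately show "(1 + p ^ (2 * N + 1)) * t n + z * p ^ N * t (n - 1) + p ^ Suc N / z * t (n + 1)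
       = tcoeff p (Suc N) n * (z powi n * p ^ tri n)"
      unfolding 1 2 3 by (simp add: t_def algebra_simps)
  qed
  also have "(1 + p ^ (2 * N + 1)) * A + z * p ^ N * A + p ^ Suc N / z * A
      = (\<Prod>k<Suc N. (1 + z * p ^ k) * (1 + p ^ Suc k / z))"
  proof -
    have "(\<Prod>k<Suc N. (1 + z * p ^ k) * (1 + p ^ Suc k / z)) = A * ((1 + z * p ^ N) * (1 + p ^ Suc N / z))"
      by (simp add: A_def)
    also have "(1 + z * p ^ N) * (1 + p ^ Suc N / z) = 1 + p ^ (2 * N + 1) + z * p ^ N + p ^ Suc N / z"
      using assms by (simp add: field_simps power_add mult_2_right)
    finally show ?thesis by (simp add: algebra_simps)
  qed
  finally show ?case .
qed

definition qfact :: "complex \<Rightarrow> nat \<Rightarrow> complex" where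
  "qfact p k = (\<Prod>j<k. 1 - p * p ^ j)"

lemma qfact_Suc: "qfact p (Suc k) = qfact p k * (1 - p * p ^ k)"
  by (simp add: qfact_def)

lemma qfact_0 [simp]: "qfact p 0 = 1"
  by (simp add: qfact_def)

lemma qfact_nonzero:
  assumes "norm p < 1"
  shows "qfact p k \<noteq> 0"
proof -
  have "p * p ^ j \<noteq> 1" for j
    using qpoch_self_nonzero[OF assms] by (auto simp: qpoch_eq_0_iff[OF assms])
  thus ?thesis by (simp add: qfact_def)
qed

text \<open>The Pascal rule for Gaussian binomials, applied twice at once since one step adds two
  factors. Here \<open>A\<close> and \<open>B\<close> stand for p^a and p^b, and \<open>Q\<close>,
  \<open>a\<close>, \<open>b\<close> for the q-factorials in the binomial.\<close>

lemma tcoeff_step: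
  fixes p A B Q a b X Y :: complex
  assumes "a \<noteq> 0" "b \<noteq> 0" "X \<noteq> 0" "Y \<noteq> 0" "X = 1 - p * A" "Y = 1 - p * B"
  shows "(1 + p * (A * B)) * (Q / (a * b)) + p * B * (Q * (1 - A) / (a * (b * Y))) + p * A * (Q * (1 - B) / (a * X * b))
    = Q * (1 - p * (A * B)) * (1 - p * (p * (A * B))) / (a * X * (b * Y))"
proof -
  have "(1 + p * (A * B)) * (Q / (a * b)) + p * B * (Q * (1 - A) / (a * (b * Y))) + p * A * (Q * (1 - B) / (a * X * b))
    = Q * ((1 + p * (A * B)) * X * Y + p * B * (1 - A) * X + p * A * (1 - B) * Y) / (a * X * (b * Y))"
    using assms(1-4) by (simp add: divide_simps) (simp add: algebra_simps)
  also have "(1 + p * (A * B)) * X * Y + p * B * (1 - A) * X + p * A * (1 - B) * Y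
      = (1 - p * (A * B)) * (1 - p * (p * (A * B)))"
    unfolding assms(5,6) by (simp add: algebra_simps)
  finally show ?thesis by (simp add: mult_ac)
qed

text \<open>The coefficients are the Gaussian binomials "2N over N + n". At the new edges
  \<open>n = N + 1\<close> and \<open>n = - (N + 1)\<close> a single term of the recursion survives,
  with factor p^0 = 1.\<close>

lemma tcoeff_closed_form:
  assumes "norm p < 1" "p \<noteq> 0"
  shows "tcoeff p N n = (if \<bar>n\<bar> \<le> int N then qfact p (2 * N) / (qfact p (nat (int N + n)) * qfact p (nat (int N - n))) else 0)"
proof (induction N arbitrary: n)
  case (Suc N)
  have nz [simp]: "qfact p k \<noteq> 0" for k using qfact_nonzero assms by auto
  have nz' [simp]: "p * p ^ k \<noteq> 1" for k using nz[of "Suc k"] by (auto simp: qfact_Suc)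
  have NN: "nat (int N + int N) = 2 * N" by simp
  consider "\<bar>n\<bar> > int N + 1" | "n = int N + 1" | "n = - (int N + 1)" | "\<bar>n\<bar> \<le> int N" by linarith
  thus ?case
  proof cases
    case 4
    define a b where "a = nat (int N + n)" "b = nat (int N - n)"
    have ab: "2 * N = a + b" "nat (int (Suc N) + n) = Suc a" "nat (int (Suc N) - n) = Suc b"
      "int N + n = int a" "int N - n = int b"
      using 4 by (auto simp: a_b_def)
    have c0: "tcoeff p N n = qfact p (a + b) / (qfact p a * qfact p b)"
      using 4 Suc.IH[of n] ab by simp
    have c1: "tcoeff p N (n - 1) = qfact p (a + b) * (1 - p ^ a) / (qfact p a * qfact p (Suc b))"
    \<comment> \<open>For \<open>a = 0\<close> the index \<open>n - 1\<close> leaves the support, in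
      accordance with the factor 1 - p^0 = 0.\<close>
    proof (cases a)
      case 0
      thus ?thesis using Suc.IH[of "n - 1"] ab by auto
    next
      case (Suc a')
      have "tcoeff p N (n - 1) = qfact p (a + b) / (qfact p a' * qfact p (Suc b))"
        using Suc.IH[of "n - 1", unfolded ab(1)] ab(2-) Suc by (auto simp: algebra_simps nat_eq_iff2)
      thus ?thesis by (simp add: Suc qfact_Suc[of p a'] field_simps)
    qed
    have c2: "tcoeff p N (n + 1) = qfact p (a + b) * (1 - p ^ b) / (qfact p (Suc a) * qfact p b)"
    proof (cases b)
      case 0
      thus ?thesis using Suc.IH[of "n + 1"] ab by auto
    next
      case (Suc b')
      have "tcoeff p N (n + 1) = qfact p (a + b) / (qfact p (Suc a) * qfact p b')"
        using Suc.IH[of "n + 1", unfolded ab(1)] ab(2-) Suc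
        by (auto simp: algebra_simps nat_eq_iff2 nat_add_distrib)
      thus ?thesis by (simp add: Suc qfact_Suc[of p b'] field_simps)
    qed
    have e: "p powi (int N - n + 1) = p * p ^ b" "p powi (int N + 1 + n) = p * p ^ a"
    proof -
      have "int N - n + 1 = int (Suc b)" "int N + 1 + n = int (Suc a)" using ab by auto
      thus "p powi (int N - n + 1) = p * p ^ b" "p powi (int N + 1 + n) = p * p ^ a"
        by (simp_all only: power_int_of_nat power_Suc)
    qed
    have "tcoeff p (Suc N) n = qfact p (Suc (Suc (a + b))) / (qfact p (Suc a) * qfact p (Suc b))"
      using tcoeff_step[of "qfact p a" "qfact p b" "1 - p * p ^ a" "1 - p * p ^ b" p "p ^ a" "p ^ b" "qfact p (a + b)"]
      by (simp add: c0 c1 c2 e ab(1) qfact_Suc power_add mult.assoc eq_commute[of 1])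
    moreover have "2 * Suc N = Suc (Suc (a + b))" "\<bar>n\<bar> \<le> int (Suc N)" using ab(1) 4 by simp_all
    ultimately show ?thesis by (simp only: ab(2,3) if_True)
  next
    case 2
    have "tcoeff p N n = 0" "tcoeff p N (n + 1) = 0" "tcoeff p N (n - 1) = 1"
      using Suc.IH[of n] Suc.IH[of "n + 1"] Suc.IH[of "n - 1"] 2 NN by simp_all
    moreover have "nat (int (Suc N) + n) = 2 * Suc N" using 2 by simp
    ultimately show ?thesis using 2 by simp
  next
    case 3
    have "tcoeff p N n = 0" "tcoeff p N (n - 1) = 0" "tcoeff p N (n + 1) = 1"
      using Suc.IH[of n] Suc.IH[of "n + 1"] Suc.IH[of "n - 1"] 3 NN by simp_all
    moreover have "nat (int (Suc N) - n) = 2 * Suc N" using 3 by simp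
    ultimately show ?thesis using 3 by simp
  next
    case 1
    thus ?thesis using Suc.IH[of n] Suc.IH[of "n + 1"] Suc.IH[of "n - 1"] by auto
  qed
qed simp


text \<open>Tannery's theorem for the finite identity: each Gaussian binomial tends to Q / (Q * Q) =
  1 / Q, and a bound uniform in \<open>N\<close> and \<open>n\<close> allows the limit to be taken
  under the sum.\<close>

lemma triple_product:
  fixes p z :: complex
  assumes "norm p < 1" "p \<noteq> 0" "z \<noteq> 0"
  shows "qpoch p p * jtheta z p = theta_series (- z) p"
proof -
  define Q where "Q = qpoch p p"
  have lim: "(\<lambda>k. qfact p k) \<longlonglongrightarrow> Q"
    using qpoch_LIMSEQ[OF assms(1), of p] by (simp add: qfact_def Q_def)
  have Q: "Q \<noteq> 0" unfolding Q_def by (rule qpoch_self_nonzero[OF assms(1)])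
  have nz: "qfact p k \<noteq> 0" for k using qfact_nonzero assms by auto
  obtain B where B: "\<And>k. norm (qfact p k) \<le> B" "B > 0"
    using convergent_imp_Bseq[of "qfact p"] lim by (auto simp: convergent_def Bseq_def)
  have "(\<lambda>k. inverse (qfact p k)) \<longlonglongrightarrow> inverse Q"
    using lim Q by (intro tendsto_intros)
  then obtain C where C: "\<And>k. norm (inverse (qfact p k)) \<le> C" "C > 0"
    using convergent_imp_Bseq[of "\<lambda>k. inverse (qfact p k)"] by (auto simp: convergent_def Bseq_def)
  have bound: "norm (tcoeff p N n) \<le> B * (C * C)" for N n
  proof (cases "\<bar>n\<bar> \<le> int N")
    case True
    have "norm (tcoeff p N n) = norm (qfact p (2 * N)) *
       (norm (inverse (qfact p (nat (int N + n)))) * norm (inverse (qfact p (nat (int N - n)))))"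
      using True by (simp add: tcoeff_closed_form[OF assms(1,2)] norm_divide norm_mult norm_inverse divide_simps)
    also have "\<dots> \<le> B * (C * C)"
      using B C by (intro mult_mono) auto
    finally show ?thesis .
  qed (use B C in \<open>simp add: tcoeff_closed_form[OF assms(1,2)]\<close>)
  have tlim: "(\<lambda>N. tcoeff p N n) \<longlonglongrightarrow> 1 / Q" for n
  proof -
    have "filterlim (\<lambda>N. nat (int N + n)) at_top sequentially"
         "filterlim (\<lambda>N. nat (int N - n)) at_top sequentially"
         "filterlim (\<lambda>N. 2 * N :: nat) at_top sequentially"
      by real_asymp+
    hence "(\<lambda>N. qfact p (2 * N) / (qfact p (nat (int N + n)) * qfact p (nat (int N - n)))) \<longlonglongrightarrow> Q / (Q * Q)"
      using Q by (intro tendsto_divide tendsto_mult filterlim_compose[OF lim]) auto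
    moreover have "eventually (\<lambda>N. qfact p (2 * N) / (qfact p (nat (int N + n)) * qfact p (nat (int N - n))) = tcoeff p N n) sequentially"
      using eventually_ge_at_top[of "nat \<bar>n\<bar>"]
      by eventually_elim (auto simp: tcoeff_closed_form[OF assms(1,2)])
    ultimately show ?thesis using Q by (simp add: tendsto_cong)
  qed
  define t where "t = (\<lambda>n. (-z) powi n * p ^ tri n)"
  have t: "(\<lambda>n. norm (t n)) summable_on UNIV"
    using abs_summable_theta[of p "-z"] assms by (simp add: t_def)
  have "(\<lambda>N. \<Sum>\<^sub>\<infinity>n. tcoeff p N n * t n) \<longlonglongrightarrow> 1 / Q * theta_series (-z) p"
  proof (rule swap_uniform_limit')
    show "uniform_limit UNIV (\<lambda>X N. \<Sum>n\<in>X. tcoeff p N n * t n) (\<lambda>N. \<Sum>\<^sub>\<infinity>n. tcoeff p N n * t n) (finite_subsets_at_top UNIV)"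
    proof (rule Weierstrass_m_test_general)
      show "norm (tcoeff p N n * t n) \<le> B * (C * C) * norm (t n)" for N n
        unfolding norm_mult by (intro mult_right_mono bound) auto
      show "(\<lambda>n. B * (C * C) * norm (t n)) summable_on UNIV"
        by (intro summable_on_cmult_right t)
    qed
    show "((\<lambda>X. \<Sum>n\<in>X. 1 / Q * t n) \<longlongrightarrow> 1 / Q * theta_series (-z) p) (finite_subsets_at_top UNIV)"
      using has_sum_cmult_right[OF has_sum_theta_series[of p "-z"], of "1 / Q"] assms
      by (simp add: has_sum_def t_def)
    show "\<forall>\<^sub>F X in finite_subsets_at_top UNIV. (\<lambda>N. \<Sum>n\<in>X. tcoeff p N n * t n) \<longlonglongrightarrow> (\<Sum>n\<in>X. 1 / Q * t n)"
      by (intro always_eventually allI tendsto_intros tlim)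
  qed auto
  moreover have "(\<Sum>\<^sub>\<infinity>n. tcoeff p N n * t n) = (\<Prod>k<N. 1 - z * p ^ k) * (\<Prod>k<N. 1 - (p / z) * p ^ k)" for N
    using infsumI[OF finite_triple_product[of p "-z" N]] assms
    by (simp add: t_def prod.distrib)
  moreover have "(\<lambda>N. (\<Prod>k<N. 1 - z * p ^ k) * (\<Prod>k<N. 1 - (p / z) * p ^ k)) \<longlonglongrightarrow> jtheta z p"
    unfolding jtheta_def by (intro tendsto_mult qpoch_LIMSEQ assms)
  ultimately have "jtheta z p = 1 / Q * theta_series (-z) p"
    using LIMSEQ_unique by fastforce
  thus ?thesis using Q by (simp add: Q_def)
qed

section \<open>The three-term relation\<close>

text \<open>Written out, these are the sums of x^(2n+1) p^(n^2+n) and of x^(2n) p^(n^2); the names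
  refer to the parity of the exponent of \<open>x\<close>.\<close>

definition theta_odd :: "complex \<Rightarrow> complex \<Rightarrow> complex" where
  "theta_odd p x = x * theta_series (x\<^sup>2 * p\<^sup>2) (p\<^sup>2)"
definition theta_even :: "complex \<Rightarrow> complex \<Rightarrow> complex" where
  "theta_even p x = theta_series (x\<^sup>2 * p) (p\<^sup>2)"

lemma has_sum_times_abs:
  fixes f :: "'i \<Rightarrow> complex" and g :: "'j \<Rightarrow> complex"
  assumes "(f has_sum a) A" "(g has_sum b) B"
    "(\<lambda>n. norm (f n)) summable_on A" "(\<lambda>n. norm (g n)) summable_on B"
  shows "((\<lambda>(i, j). f i * g j) has_sum a * b) (A \<times> B)"
proof -
  have "(\<lambda>x. norm (case x of (i, j) \<Rightarrow> f i * g j)) summable_on (A \<times> B)"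
    unfolding Infinite_Sum.abs_summable_on_Sigma_iff
    using assms
    by (auto simp: norm_mult abs_mult infsum_cmult_right' intro!: summable_on_cmult_right summable_on_cmult_left)
  hence "(\<lambda>(i, j). f i * g j) summable_on (A \<times> B)"
    by (rule abs_summable_summable)
  thus ?thesis
    using assms by (intro has_sum_SigmaI[where g = "\<lambda>i. f i * b"] has_sum_cmult_left)
      (auto intro!: has_sum_cmult_right)
qed

text \<open>
  Splitting the double series \<open>theta_series (- (x * y)) p * theta_series (- (x / y)) p\<close> by the parity of
  the sum of the two indices separates the variables.
\<close>
lemma theta_series_mult:
  fixes p x y :: complex
  assumes p: "norm p < 1" "p \<noteq> 0" and xy: "x \<noteq> 0" "y \<noteq> 0"
  shows "theta_series (- (x * y)) p * theta_series (- (x / y)) p = x * (theta_odd p x * theta_even p y - theta_even p x * theta_odd p y)"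
proof -
  define t where "t = (\<lambda>z (n::int). (-z) powi n * p ^ tri n)"
  define F where "F = (\<lambda>(m, n). t (x * y) m * t (x / y) n)"
  have t: "(t z has_sum theta_series (-z) p) UNIV" "(\<lambda>n. norm (t z n)) summable_on UNIV" if "z \<noteq> 0" for z
    using that has_sum_theta_series[of p "-z"] abs_summable_theta[of p "-z"] p by (auto simp: t_def)
  have F: "(F has_sum theta_series (- (x * y)) p * theta_series (- (x / y)) p) UNIV"
    using has_sum_times_abs[OF t(1) t(1) t(2) t(2), of "x * y" "x / y"] xy by (simp add: F_def)
  define E where "E = {(m, n). even (m + n :: int)}"
  have p2: "norm (p\<^sup>2) < 1" using p by (simp add: norm_power power_less_one_iff)
  define s where "s = (\<lambda>z (n::int). z powi n * (p\<^sup>2) ^ tri n)"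
  have s: "(s z has_sum theta_series z (p\<^sup>2)) UNIV" "(\<lambda>n. norm (s z n)) summable_on UNIV" if "z \<noteq> 0" for z
    using that has_sum_theta_series[of "p\<^sup>2" z] abs_summable_theta[of "p\<^sup>2" z] p2 by (auto simp: s_def)
  have G1: "((\<lambda>(i, j). x\<^sup>2 * (s (x\<^sup>2 * p\<^sup>2) i * s (y\<^sup>2 * p) j)) has_sum x * (theta_odd p x * theta_even p y)) UNIV"
    using has_sum_cmult_right[OF has_sum_times_abs[OF s(1) s(1) s(2) s(2), of "x\<^sup>2 * p\<^sup>2" "y\<^sup>2 * p"], of "x\<^sup>2"] p xy
    by (simp add: theta_odd_def theta_even_def power2_eq_square mult_ac case_prod_unfold)
  have G2: "((\<lambda>(i, j). - x * y * (s (x\<^sup>2 * p) i * s (y\<^sup>2 * p\<^sup>2) j)) has_sum - (x * (theta_even p x * theta_odd p y))) UNIV"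
    using has_sum_cmult_right[OF has_sum_times_abs[OF s(1) s(1) s(2) s(2), of "x\<^sup>2 * p" "y\<^sup>2 * p\<^sup>2"], of "- x * y"] p xy
    by (simp add: theta_odd_def theta_even_def power2_eq_square mult_ac case_prod_unfold)
  have T: "t (x * y) m * t (x / y) n = (-1) powi (m + n) * x powi (m + n) * y powi (m - n) * p powi (int (tri m) + int (tri n))" for m n
  proof -
    have "(- (x * y)) powi m = (-1) powi m * x powi m * y powi m"
      by (metis mult_minus1 power_int_mult_distrib mult.assoc)
    moreover have "(- (x / y)) powi n = (-1) powi n * x powi n / y powi n"
      by (metis mult_minus1 power_int_mult_distrib power_int_divide_distrib times_divide_eq_right)
    ultimately show ?thesis using p xy
      by (simp add: t_def power_int_add power_int_diff)
  qed
  have S: "s z i = z powi i * p powi (i * (i - 1))" if "z \<noteq> 0" for z i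
  proof -
    have "(p\<^sup>2) ^ tri i = p powi (2 * int (tri i))"
      by (metis power_int_of_nat power_mult of_nat_mult of_nat_numeral)
    thus ?thesis by (simp add: s_def tri_eq)
  qed
  have sq: "w\<^sup>2 powi k = (w powi k)\<^sup>2" for w :: complex and k
    by (simp add: power2_eq_square power_int_mult_distrib)
  have even1: "(-1 :: complex) powi k = (if even k then 1 else -1)" for k
    by (auto simp: power_int_minus_left)
  \<comment> \<open>The term with indices m, n carries x^(m+n) y^(m-n). Even sums are parametrised
    by m + n = 2i + 2 and m - n = 2j, odd sums by m + n = 2i + 1 and m - n = 2j + 1. The offset 2 in
    the even case leaves exactly one factor \<open>x\<close> in front of both parts.\<close>
  have E1: "range (\<lambda>(i, j). (i + j + 1, i + 1 - j)) = E"
  proof (intro equalityI subsetI)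
    fix mn assume "mn \<in> E"
    then obtain m n where mn: "mn = (m, n)" "even (m + n)"
      by (auto simp: E_def)
    then obtain k where "m + n = 2 * k" by (elim evenE)
    thus "mn \<in> range (\<lambda>(i, j). (i + j + 1, i + 1 - j))"
      using mn by (intro range_eqI[of _ _ "(k - 1, m - k)"]) auto
  qed (auto simp: E_def)
  have E2: "range (\<lambda>(i, j). (i + j + 1, i - j)) = - E"
  proof (intro equalityI subsetI)
    fix mn assume "mn \<in> - E"
    then obtain m n where mn: "mn = (m, n)" "odd (m + n)"
      by (auto simp: E_def)
    then obtain k where "m + n = 2 * k + 1" by (elim oddE)
    thus "mn \<in> range (\<lambda>(i, j). (i + j + 1, i - j))"
      using mn by (intro range_eqI[of _ _ "(k, m - k - 1)"]) auto
  qed (auto simp: E_def)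
  have "(F has_sum x * (theta_odd p x * theta_even p y)) E"
  proof -
    have "F (i + j + 1, i + 1 - j) = x\<^sup>2 * (s (x\<^sup>2 * p\<^sup>2) i * s (y\<^sup>2 * p) j)" for i j
    proof -
      have "2 * (int (tri (i + j + 1)) + int (tri (i + 1 - j))) = 2 * (i * (i - 1) + j * (j - 1) + 2 * i + j)"
        using tri_eq[of "i + j + 1"] tri_eq[of "i + 1 - j"] by (simp add: algebra_simps)
      hence e: "int (tri (i + j + 1)) + int (tri (i + 1 - j)) = i * (i - 1) + j * (j - 1) + 2 * i + j" by simp
      have e': "i + j + 1 + (i + 1 - j) = 2 * i + 2" "i + j + 1 - (i + 1 - j) = 2 * j" by simp_all
      show ?thesis
        unfolding F_def prod.case T e e' using p xy
        by (simp add: S sq even1 power_int_add power_int_mult power_int_mult_distrib mult_ac)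
    qed
    thus ?thesis
      using G1 has_sum_reindex[of "\<lambda>(i, j). (i + j + 1, i + 1 - j)" UNIV F] E1
      by (simp add: o_def case_prod_unfold inj_on_def)
  qed
  moreover have "(F has_sum - (x * (theta_even p x * theta_odd p y))) (- E)"
  proof -
    have "F (i + j + 1, i - j) = - x * y * (s (x\<^sup>2 * p) i * s (y\<^sup>2 * p\<^sup>2) j)" for i j
    proof -
      have "2 * (int (tri (i + j + 1)) + int (tri (i - j))) = 2 * (i * (i - 1) + j * (j - 1) + i + 2 * j)"
        using tri_eq[of "i + j + 1"] tri_eq[of "i - j"] by (simp add: algebra_simps)
      hence e: "int (tri (i + j + 1)) + int (tri (i - j)) = i * (i - 1) + j * (j - 1) + i + 2 * j" by simp
      have e': "i + j + 1 + (i - j) = 2 * i + 1" "i + j + 1 - (i - j) = 2 * j + 1" by simp_all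
      show ?thesis
        unfolding F_def prod.case T e e' using p xy
        by (simp add: S sq even1 power_int_add power_int_mult power_int_mult_distrib mult_ac)
    qed
    thus ?thesis
      using G2 has_sum_reindex[of "\<lambda>(i, j). (i + j + 1, i - j)" UNIV F] E2
      by (simp add: o_def case_prod_unfold inj_on_def)
  qed
  ultimately have "(F has_sum (x * (theta_odd p x * theta_even p y) + - (x * (theta_even p x * theta_odd p y)))) (E \<union> - E)"
    by (intro has_sum_Un_disjoint) auto
  hence "(F has_sum (x * (theta_odd p x * theta_even p y) + - (x * (theta_even p x * theta_odd p y)))) UNIV"
    by simp
  thus ?thesis using has_sum_unique[OF F] by (simp add: algebra_simps)
qed

definition theta_pair :: "complex \<Rightarrow> complex \<Rightarrow> complex \<Rightarrow> complex" where
  "theta_pair p x y = jtheta (x * y) p * jtheta (x / y) p / x"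

text \<open>Weierstrass's three-term addition formula in multiplicative form. By \<open>M\<close>
  every \<open>theta_pair\<close> is a 2 by 2 minor built from the vectors
  (\<open>theta_odd\<close>, \<open>theta_even\<close>), up to a common factor, so only the
  quadratic relation between the minors of a 2 by 4 matrix remains.\<close>

theorem theta_three_term:
  fixes p a b c d :: complex
  assumes p: "norm p < 1" "p \<noteq> 0" and nz: "a \<noteq> 0" "b \<noteq> 0" "c \<noteq> 0" "d \<noteq> 0"
  shows "theta_pair p a b * theta_pair p c d - theta_pair p a c * theta_pair p b d
           + theta_pair p a d * theta_pair p b c = 0"
proof -
  have Q: "qpoch p p \<noteq> 0" by (rule qpoch_self_nonzero[OF p(1)])
  have M: "theta_pair p x y = (theta_odd p x * theta_even p y - theta_even p x * theta_odd p y) / (qpoch p p)\<^sup>2"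
    if "x \<noteq> 0" "y \<noteq> 0" for x y
  proof -
    have "(qpoch p p)\<^sup>2 * theta_pair p x y
        = (qpoch p p * jtheta (x * y) p) * (qpoch p p * jtheta (x / y) p) / x"
      by (simp add: theta_pair_def power2_eq_square)
    also have "\<dots> = theta_odd p x * theta_even p y - theta_even p x * theta_odd p y"
      using that p by (simp add: triple_product theta_series_mult)
    finally show ?thesis using Q by (simp add: field_simps)
  qed
  show ?thesis
    using nz Q by (simp add: M field_simps)
qed

section \<open>Cubic theta identities\<close>

lemma jtheta_trisect:
  fixes p z :: "'a::{real_normed_field,banach}"
  assumes "norm p < 1" "p \<noteq> 0" "z \<noteq> 0"
  shows "jtheta z p = jtheta z (p ^ 3) * jtheta (p * z) (p ^ 3) * jtheta (p ^ 2 * z) (p ^ 3)"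
proof -
  have "p ^ 3 / (p * z) = p / z * p" "p ^ 3 / (p\<^sup>2 * z) = p / z" "p ^ 3 / z = p / z * p\<^sup>2"
    using assms by (simp_all add: power3_eq_cube power2_eq_square field_simps)
  thus ?thesis
    using qpoch_multisect[OF assms(1), of 3 z] qpoch_multisect[OF assms(1), of 3 "p / z"]
    by (simp add: jtheta_def eval_nat_numeral mult_ac)
qed

lemma jtheta_third:
  fixes p :: "'a::{real_normed_field,banach}"
  assumes "norm p < 1" "p \<noteq> 0"
  shows "jtheta p (p ^ 3) = qpoch p p / qpoch (p ^ 3) (p ^ 3)"
proof -
  have "norm (p ^ 3) < 1" using assms by (simp add: norm_power power_less_one_iff)
  moreover have "p ^ 3 / p = p * p" using assms by (simp add: power3_eq_cube)
  ultimately show ?thesis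
    using qpoch_multisect[OF assms(1), of 3 p] qpoch_self_nonzero[of "p ^ 3"]
    by (simp add: jtheta_def eval_nat_numeral mult_ac)
qed

lemma qpoch_pentasect:
  fixes q :: "'a::{real_normed_field,banach}"
  assumes "norm q < 1" "q \<noteq> 0"
  shows "jtheta q (q ^ 5) * jtheta (q\<^sup>2) (q ^ 5) = qpoch q q / qpoch (q ^ 5) (q ^ 5)"
proof -
  have "norm (q ^ 5) < 1" using assms by (simp add: norm_power power_less_one_iff)
  moreover have "q ^ 5 / q = q ^ 4" "q ^ 5 / q\<^sup>2 = q ^ 3" using assms by (simp_all add: eval_nat_numeral)
  ultimately show ?thesis
    using qpoch_multisect[OF assms(1), of 5 q] qpoch_self_nonzero[of "q ^ 5"]
    by (simp add: jtheta_def eval_nat_numeral mult_ac)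
qed

lemma qpoch_cube_roots:
  fixes p z w :: complex
  assumes "norm p < 1" "w\<^sup>2 + w + 1 = 0"
  shows "qpoch z p * qpoch (w * z) p * qpoch (w\<^sup>2 * z) p = qpoch (z ^ 3) (p ^ 3)"
proof -
  have "norm (p ^ 3) < 1" using assms by (simp add: norm_power power_less_one_iff)
  have "(\<lambda>N. (\<Prod>n<N. 1 - z * p ^ n) * (\<Prod>n<N. 1 - w * z * p ^ n) * (\<Prod>n<N. 1 - w\<^sup>2 * z * p ^ n))
      \<longlonglongrightarrow> qpoch z p * qpoch (w * z) p * qpoch (w\<^sup>2 * z) p"
    by (intro tendsto_mult qpoch_LIMSEQ assms)
  also have "(\<lambda>N. (\<Prod>n<N. 1 - z * p ^ n) * (\<Prod>n<N. 1 - w * z * p ^ n) * (\<Prod>n<N. 1 - w\<^sup>2 * z * p ^ n))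
    = (\<lambda>N. \<Prod>n<N. 1 - z ^ 3 * (p ^ 3) ^ n)"
  proof (rule ext)
    fix N
    have "(1 - a) * (1 - w * a) * (1 - w\<^sup>2 * a) = 1 - a ^ 3" for a
      using assms(2) by algebra
    from this[of "z * p ^ n" for n]
    have "(1 - z * p ^ n) * (1 - w * z * p ^ n) * (1 - w\<^sup>2 * z * p ^ n) = 1 - (z * p ^ n) ^ 3" for n
      by (simp only: mult.assoc)
    moreover have "(z * p ^ n) ^ 3 = z ^ 3 * (p ^ 3) ^ n" for n
      by (simp add: power_mult_distrib mult.commute flip: power_mult)
    ultimately have "(1 - z * p ^ n) * (1 - w * z * p ^ n) * (1 - w\<^sup>2 * z * p ^ n) = 1 - z ^ 3 * (p ^ 3) ^ n" for n
      by simp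
    thus "(\<Prod>n<N. 1 - z * p ^ n) * (\<Prod>n<N. 1 - w * z * p ^ n) * (\<Prod>n<N. 1 - w\<^sup>2 * z * p ^ n)
      = (\<Prod>n<N. 1 - z ^ 3 * (p ^ 3) ^ n)"
      by (simp flip: prod.distrib)
  qed
  finally show ?thesis
    using LIMSEQ_unique qpoch_LIMSEQ[OF \<open>norm (p ^ 3) < 1\<close>] by blast
qed

lemma jtheta_cube_roots:
  fixes p z w :: complex
  assumes "norm p < 1" "w\<^sup>2 + w + 1 = 0" "z \<noteq> 0"
  shows "jtheta z p * (jtheta (w * z) p * jtheta (w\<^sup>2 * z) p) = jtheta (z ^ 3) (p ^ 3)"
proof -
  have w: "w \<noteq> 0" using assms by auto
  have "w ^ 3 = 1" using assms(2) by algebra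
  hence "1 / w = w\<^sup>2" "1 / w\<^sup>2 = w" using w by (simp_all add: field_simps power3_eq_cube power2_eq_square)
  hence e: "p / (w * z) = w\<^sup>2 * (p / z)" "p / (w\<^sup>2 * z) = w * (p / z)"
    by (metis times_divide_times_eq mult_1)+
  have "jtheta z p * (jtheta (w * z) p * jtheta (w\<^sup>2 * z) p)
      = (qpoch z p * qpoch (w * z) p * qpoch (w\<^sup>2 * z) p)
        * (qpoch (p / z) p * qpoch (w * (p / z)) p * qpoch (w\<^sup>2 * (p / z)) p)"
    unfolding jtheta_def e by (simp only: mult_ac)
  moreover have "jtheta (z ^ 3) (p ^ 3) = qpoch (z ^ 3) (p ^ 3) * qpoch ((p / z) ^ 3) (p ^ 3)"
    by (simp add: jtheta_def power_divide)
  ultimately show ?thesis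
    unfolding qpoch_cube_roots[OF assms(1,2)] by simp
qed

lemma three_term_clear_denoms:
  fixes z y :: complex
  assumes "z \<noteq> 0" "y \<noteq> 0" "a / z * b - c / z * (d / y) + e / z * (f / y) = 0"
  shows "c * d - f * e = b * y * a"
proof -
  have "z * y * (a / z * b - c / z * (d / y) + e / z * (f / y)) = a * b * y - c * d + e * f"
    using assms(1,2) by (simp add: field_simps)
  hence "a * b * y - c * d + e * f = 0" using assms(3) by (simp only: mult_zero_right)
  thus ?thesis by (simp add: algebra_simps)
qed

text \<open>The three-term relation at \<open>(z, y, 1, w)\<close>. Since
  \<open>1 / w = w^2\<close>, pairing \<open>x\<close> with \<open>w\<close> produces the two theta
  values at \<open>w * x\<close> and \<open>w^2 * x\<close>; multiplication by
  \<open>jtheta z p * jtheta y p\<close> completes these to theta values in base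
  \<open>p ^ 3\<close>. The constant 3 is (1 - w)(1 - w^2).\<close>

lemma theta_cubic_identity:
  fixes p z y :: complex
  assumes p: "norm p < 1" "p \<noteq> 0" and nz: "z \<noteq> 0" "y \<noteq> 0"
  shows "jtheta z p ^ 3 * jtheta (y ^ 3) (p ^ 3) - jtheta y p ^ 3 * jtheta (z ^ 3) (p ^ 3)
    = 3 * y * jtheta (z * y) p * jtheta (z / y) p * jtheta z p * jtheta y p
        * (qpoch (p ^ 3) (p ^ 3) / qpoch p p)\<^sup>2"
proof -
  define w where "w = Complex (- 1 / 2) (sqrt 3 / 2)"
  have w1: "w\<^sup>2 + w + 1 = 0"
    by (simp add: w_def power2_eq_square complex_eq_iff)
  have w: "w \<noteq> 0" using w1 by auto
  have w3: "w ^ 3 = 1" using w1 by algebra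
  hence inv: "1 / w = w\<^sup>2" "x / w = w\<^sup>2 * x" for x
    using w by (simp_all add: field_simps power3_eq_cube power2_eq_square)
  define E where "E = qpoch (p ^ 3) (p ^ 3) / qpoch p p"
  have "jtheta w p * jtheta (w\<^sup>2) p = 3 * E\<^sup>2"
  proof -
    have "qpoch (w * p) p * qpoch (w\<^sup>2 * p) p = E"
      using qpoch_cube_roots[OF p(1) w1, of p] qpoch_self_nonzero[OF p(1)] by (simp add: E_def field_simps)
    moreover have "p / w = w\<^sup>2 * p" by (rule inv)
    moreover have "p / w\<^sup>2 = w * p" using w3 w by (simp add: field_simps power3_eq_cube power2_eq_square)
    moreover have "qpoch w p = (1 - w) * qpoch (w * p) p" "qpoch (w\<^sup>2) p = (1 - w\<^sup>2) * qpoch (w\<^sup>2 * p) p"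
      by (rule qpoch_head[OF p(1)])+
    ultimately have "jtheta w p * jtheta (w\<^sup>2) p = (1 - w) * (1 - w\<^sup>2) * E\<^sup>2"
      unfolding jtheta_def by (simp only:) (simp add: power2_eq_square mult_ac flip: \<open>_ = E\<close>)
    also have "(1 - w) * (1 - w\<^sup>2) = 3" using w1 by algebra
    finally show ?thesis .
  qed
  hence M: "theta_pair p 1 w = 3 * E\<^sup>2"
    by (simp add: theta_pair_def inv)
  define T where "T = (\<lambda>x. jtheta (w * x) p * jtheta (w\<^sup>2 * x) p)"
  have Mw: "theta_pair p x w = T x / x" for x
    by (simp add: theta_pair_def T_def inv mult.commute)
  have M1: "theta_pair p x 1 = jtheta x p ^ 2 / x" for x
    by (simp add: theta_pair_def power2_eq_square)
  note three_term_clear_denoms[OF nz theta_three_term[OF p nz one_neq_zero w, unfolded M, unfolded Mw M1 theta_pair_def[of _ z y]]]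
  hence "jtheta z p ^ 2 * T y - jtheta y p ^ 2 * T z = 3 * E\<^sup>2 * y * jtheta (z * y) p * jtheta (z / y) p"
    by (simp only: mult_ac)
  hence "jtheta z p * jtheta y p * (jtheta z p ^ 2 * T y - jtheta y p ^ 2 * T z)
      = 3 * y * jtheta (z * y) p * jtheta (z / y) p * jtheta z p * jtheta y p * E\<^sup>2"
    by simp
  moreover have h: "jtheta (x ^ 3) (p ^ 3) = jtheta x p * T x" if "x \<noteq> 0" for x
    using jtheta_cube_roots[OF p(1) w1 that] by (simp add: T_def)
  have "jtheta z p * jtheta y p * (jtheta z p ^ 2 * T y - jtheta y p ^ 2 * T z)
     = jtheta z p ^ 3 * jtheta (y ^ 3) (p ^ 3) - jtheta y p ^ 3 * jtheta (z ^ 3) (p ^ 3)"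
    unfolding h[OF nz(1)] h[OF nz(2)] by (simp add: power3_eq_cube power2_eq_square algebra_simps)
  ultimately show ?thesis by (simp add: E_def)
qed

text \<open>The same argument in base \<open>p ^ 3\<close>, with \<open>p\<close> itself in the role
  of the cube root of unity: its cube is trivial modulo powers of the base. Now multisection,
  instead of the product over roots of unity, completes the theta values.\<close>

lemma theta_cubic_identity_dual:
  fixes p z y :: complex
  assumes p: "norm p < 1" "p \<noteq> 0" and nz: "z \<noteq> 0" "y \<noteq> 0"
  shows "jtheta z (p ^ 3) ^ 3 * jtheta y p - z / y * jtheta y (p ^ 3) ^ 3 * jtheta z p
    = (qpoch p p / qpoch (p ^ 3) (p ^ 3))\<^sup>2 * jtheta (z * y) (p ^ 3) * jtheta (z / y) (p ^ 3)
        * jtheta z (p ^ 3) * jtheta y (p ^ 3)"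
proof -
  define r where "r = p ^ 3"
  have r: "norm r < 1" "r \<noteq> 0" using p by (auto simp: r_def norm_power power_less_one_iff)
  define E where "E = jtheta p r"
  define T where "T = (\<lambda>x. jtheta (p * x) r * jtheta (p\<^sup>2 * x) r)"
  \<comment> \<open>The quasi-period \<open>p ^ 3\<close> moves \<open>x / p\<close> to
    \<open>p^2 * x\<close>, the third point needed by \<open>jtheta_trisect\<close>.\<close>
  have Mp: "theta_pair r x p = - T x / p" if "x \<noteq> 0" for x
  proof -
    have "jtheta (p\<^sup>2 * x) r = - jtheta (x / p) r / (x / p)"
      using jtheta_shift[OF r(1) _ r(2), of "x / p"] that p
      by (simp add: r_def power3_eq_cube power2_eq_square mult_ac)
    hence "jtheta (x / p) r = - (x / p) * jtheta (p\<^sup>2 * x) r" using that p by (simp add: field_simps)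
    thus ?thesis using that by (simp add: theta_pair_def T_def mult.commute)
  qed
  have M1p: "theta_pair r 1 p = - E\<^sup>2 / p"
    using jtheta_inverse[OF r(1), of p] p by (simp add: theta_pair_def E_def power2_eq_square)
  have M1: "theta_pair r x 1 = jtheta x r ^ 2 / x" for x
    by (simp add: theta_pair_def power2_eq_square)
  have "theta_pair r z y * theta_pair r 1 p - theta_pair r z 1 * theta_pair r y p + theta_pair r z p * theta_pair r y 1 = 0"
    using theta_three_term[OF r nz, of 1 p] p by simp
  hence "jtheta z r ^ 2 * T y - z / y * jtheta y r ^ 2 * T z = E\<^sup>2 * jtheta (z * y) r * jtheta (z / y) r"
    unfolding Mp[OF nz(1)] Mp[OF nz(2)] M1 M1p theta_pair_def[of _ z y]
    using nz p by (simp add: divide_simps) (simp add: algebra_simps)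
  hence "jtheta z r * jtheta y r * (jtheta z r ^ 2 * T y - z / y * jtheta y r ^ 2 * T z)
      = E\<^sup>2 * jtheta (z * y) r * jtheta (z / y) r * jtheta z r * jtheta y r"
    by simp
  moreover have "jtheta x p = jtheta x r * T x" if "x \<noteq> 0" for x
    using jtheta_trisect[OF p that] by (simp add: T_def r_def mult.assoc)
  ultimately show ?thesis
    using nz jtheta_third[OF p] by (simp add: E_def r_def power3_eq_cube power2_eq_square algebra_simps)
qed

text \<open>\<open>th1\<close> and \<open>th2\<close> are the reciprocals of the Rogers-Ramanujan
  functions G and H, so that R(q) = q^(1/5) \<open>th1 q / th2 q\<close>.\<close>

definition th1 :: "real \<Rightarrow> real" where "th1 q = jtheta q (q ^ 5)"
definition th2 :: "real \<Rightarrow> real" where "th2 q = jtheta (q\<^sup>2) (q ^ 5)"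
definition euler_f :: "real \<Rightarrow> real" where "euler_f q = qpoch q q"

lemma rr_theta_mult:
  assumes "0 < q" "q < 1"
  shows "th1 q * th2 q = euler_f q / euler_f (q ^ 5)"
  using qpoch_pentasect[of q] assms by (simp add: th1_def th2_def euler_f_def)

text \<open>Up to a power of q, the left side is the numerator of R(q^3) - R(q)^3 over the
  denominator \<open>th2 q ^ 3 * th2 (q ^ 3)\<close>.\<close>

lemma rr_theta_identity1:
  assumes q: "0 < q" "q < 1"
  shows "th2 q ^ 3 * th1 (q ^ 3) - th1 q ^ 3 * th2 (q ^ 3)
    = 3 * q * (th1 q * th2 q)\<^sup>2 * (euler_f (q ^ 15) / euler_f (q ^ 5))\<^sup>2"
proof -
  have a: "\<bar>q ^ 5\<bar> < 1" "\<bar>q ^ 15\<bar> < 1" using q by (simp_all add: power_less_one_iff)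
  define Q where "Q = complex_of_real q"
  have "complex_of_real (th2 q ^ 3 * th1 (q ^ 3) - th1 q ^ 3 * th2 (q ^ 3)) =
     complex_of_real (3 * q * jtheta (q ^ 3) (q ^ 5) * jtheta q (q ^ 5) * th2 q * th1 q * (euler_f (q ^ 15) / euler_f (q ^ 5))\<^sup>2)"
    using theta_cubic_identity[of "Q ^ 5" "Q\<^sup>2" Q] q a
    by (simp add: Q_def th1_def th2_def euler_f_def of_real_jtheta of_real_qpoch norm_power
        power_less_one_iff power2_eq_square flip: power_mult power_add power_Suc2 power_Suc)
       (simp add: eval_nat_numeral mult_ac)
  hence "th2 q ^ 3 * th1 (q ^ 3) - th1 q ^ 3 * th2 (q ^ 3)
     = 3 * q * jtheta (q ^ 3) (q ^ 5) * jtheta q (q ^ 5) * th2 q * th1 q * (euler_f (q ^ 15) / euler_f (q ^ 5))\<^sup>2"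
    by (simp only: of_real_eq_iff)
  moreover have "jtheta (q ^ 3) (q ^ 5) = th2 q"
    using jtheta_reflect[of "q ^ 5" "q\<^sup>2"] q by (simp add: th2_def flip: power_diff)
  ultimately show ?thesis by (simp add: th1_def power2_eq_square mult_ac)
qed

text \<open>The left side is the numerator of 1 + R(q) R(q^3)^3 over the denominator
  \<open>th2 q * th2 (q ^ 3) ^ 3\<close>.\<close>

lemma rr_theta_identity2:
  assumes q: "0 < q" "q < 1"
  shows "th2 q * th2 (q ^ 3) ^ 3 + q\<^sup>2 * th1 q * th1 (q ^ 3) ^ 3
    = (th1 (q ^ 3) * th2 (q ^ 3))\<^sup>2 * (euler_f (q ^ 5) / euler_f (q ^ 15))\<^sup>2"
proof -
  have a: "\<bar>q ^ 5\<bar> < 1" "\<bar>q ^ 15\<bar> < 1" using q by (simp_all add: power_less_one_iff)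
  define Q where "Q = complex_of_real q"
  have "complex_of_real (jtheta (q ^ 6) (q ^ 15) ^ 3 * jtheta (q ^ 3) (q ^ 5) - q ^ 3 * jtheta (q ^ 3) (q ^ 15) ^ 3 * jtheta (q ^ 6) (q ^ 5)) =
     complex_of_real ((euler_f (q ^ 5) / euler_f (q ^ 15))\<^sup>2 * jtheta (q ^ 9) (q ^ 15) * jtheta (q ^ 3) (q ^ 15)
        * jtheta (q ^ 6) (q ^ 15) * jtheta (q ^ 3) (q ^ 15))"
    using theta_cubic_identity_dual[of "Q ^ 5" "Q ^ 6" "Q ^ 3"] q a
    by (simp add: Q_def euler_f_def of_real_jtheta of_real_qpoch norm_power
        power_less_one_iff flip: power_mult power_add power_diff)
  hence "jtheta (q ^ 6) (q ^ 15) ^ 3 * jtheta (q ^ 3) (q ^ 5) - q ^ 3 * jtheta (q ^ 3) (q ^ 15) ^ 3 * jtheta (q ^ 6) (q ^ 5) =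
     ((euler_f (q ^ 5) / euler_f (q ^ 15))\<^sup>2 * jtheta (q ^ 9) (q ^ 15) * jtheta (q ^ 3) (q ^ 15)
        * jtheta (q ^ 6) (q ^ 15) * jtheta (q ^ 3) (q ^ 15))"
    by (simp only: of_real_eq_iff)
  moreover have "jtheta (q ^ 3) (q ^ 5) = th2 q"
    using jtheta_reflect[of "q ^ 5" "q\<^sup>2"] q by (simp add: th2_def flip: power_diff)
  moreover have "jtheta (q ^ 9) (q ^ 15) = th2 (q ^ 3)"
    using jtheta_reflect[of "q ^ 15" "q ^ 6"] q by (simp add: th2_def flip: power_mult power_diff)
  moreover have "jtheta (q ^ 6) (q ^ 15) = th2 (q ^ 3)" "jtheta (q ^ 3) (q ^ 15) = th1 (q ^ 3)"
    by (simp_all add: th1_def th2_def flip: power_mult)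
  \<comment> \<open>One quasi-period brings the argument back to \<open>q\<close>; its sign turns
    the difference of the dual identity into a sum.\<close>
  moreover have "jtheta (q ^ 6) (q ^ 5) = - th1 q / q"
    using jtheta_shift[of "q ^ 5" q] a q by (simp add: th1_def flip: power_Suc2)
  ultimately have "th2 q * th2 (q ^ 3) ^ 3 - q ^ 3 * th1 (q ^ 3) ^ 3 * (- th1 q / q)
      = (th1 (q ^ 3) * th2 (q ^ 3))\<^sup>2 * (euler_f (q ^ 5) / euler_f (q ^ 15))\<^sup>2"
    by (simp only: mult_ac power2_eq_square)
  moreover have "th2 q * x ^ 3 - q ^ 3 * y ^ 3 * (- th1 q / q) = th2 q * x ^ 3 + q\<^sup>2 * th1 q * y ^ 3" for x y
    using q by (simp add: power3_eq_cube power2_eq_square)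
  ultimately show ?thesis by metis
qed

section \<open>The logarithmic derivative of the continued fraction\<close>

text \<open>The higher-order terms of the product are majorised by those of the exponential of the
  sum of norms, so the bound survives the passage to infinite products.\<close>

lemma norm_prod_first_order:
  fixes a :: "nat \<Rightarrow> 'a::{real_normed_field}"
  shows "norm ((\<Prod>n<N. 1 + a n) - 1 - (\<Sum>n<N. a n)) \<le> exp (\<Sum>n<N. norm (a n)) - 1 - (\<Sum>n<N. norm (a n))"
proof (induction N)
  case (Suc N)
  define P s S where "P = (\<Prod>n<N. 1 + a n)" "s = (\<Sum>n<N. a n)" "S = (\<Sum>n<N. norm (a n))"
  have "norm (P - 1) \<le> (\<Prod>n<N. 1 + norm (a n)) - 1"
    unfolding P_s_S_def by (rule norm_prod_minus1_le_prod_minus1)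
  also have "(\<Prod>n<N. 1 + norm (a n)) \<le> exp S"
    unfolding P_s_S_def by (rule prod_le_exp_sum) auto
  finally have P1: "norm (P - 1) \<le> exp S - 1" by simp
  have "(\<Prod>n<Suc N. 1 + a n) - 1 - (\<Sum>n<Suc N. a n) = (P - 1 - s) + a N * (P - 1)"
    by (simp add: P_s_S_def algebra_simps)
  also have "norm \<dots> \<le> (exp S - 1 - S) + norm (a N) * (exp S - 1)"
    using Suc P1 by (intro order_trans[OF norm_triangle_ineq] add_mono)
      (auto simp: P_s_S_def norm_mult intro: mult_left_mono)
  also have "\<dots> = exp S * (1 + norm (a N)) - 1 - (S + norm (a N))"
    by (simp add: algebra_simps)
  also have "exp S * (1 + norm (a N)) \<le> exp S * exp (norm (a N))"
    by (intro mult_left_mono exp_ge_add_one_self) auto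
  finally show ?case by (simp add: P_s_S_def exp_add)
qed simp

text \<open>The exponential bound makes the error at most the square of \<open>norm k * S\<close>
  once \<open>norm k * S < 1\<close>, which exceeds linear order in \<open>k\<close>.\<close>

lemma prodinf_first_order:
  fixes c :: "nat \<Rightarrow> complex"
  assumes "summable (\<lambda>n. norm (c n))"
  shows "((\<lambda>k. ((\<Prod>n. 1 - k * c n) - 1) / k) \<longlongrightarrow> - (\<Sum>n. c n)) (at 0)"
proof -
  define S where "S = (\<Sum>n. norm (c n))"
  have S: "S \<ge> 0" using assms by (simp add: S_def suminf_nonneg)
  have "norm ((\<Prod>n. 1 - k * c n) - 1 + k * (\<Sum>n. c n)) \<le> exp (norm k * S) - 1 - norm k * S" for k
  proof -
    have sc: "summable c" using assms by (rule summable_norm_cancel)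
    have "abs_convergent_prod (\<lambda>n. 1 - k * c n)"
      using assms by (intro summable_imp_abs_convergent_prod) (auto simp: norm_mult intro: summable_mult)
    hence "(\<lambda>n. 1 - k * c n) has_prod (\<Prod>n. 1 - k * c n)"
      by (intro convergent_prod_has_prod abs_convergent_prod_imp_convergent_prod)
    hence "(\<lambda>N. \<Prod>n<N. 1 - k * c n) \<longlonglongrightarrow> (\<Prod>n. 1 - k * c n)"
      by (rule has_prod_imp_tendsto')
    hence "(\<lambda>N. norm ((\<Prod>n<N. 1 - k * c n) - 1 + k * (\<Sum>n<N. c n))) \<longlonglongrightarrow> norm ((\<Prod>n. 1 - k * c n) - 1 + k * (\<Sum>n. c n))"
      by (intro tendsto_intros summable_LIMSEQ sc)
    moreover have "(\<lambda>N. exp (norm k * (\<Sum>n<N. norm (c n))) - 1 - norm k * (\<Sum>n<N. norm (c n))) \<longlonglongrightarrow> exp (norm k * S) - 1 - norm k * S"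
      unfolding S_def by (intro tendsto_intros summable_LIMSEQ assms)
    moreover have "norm ((\<Prod>n<N. 1 - k * c n) - 1 + k * (\<Sum>n<N. c n)) \<le> exp (norm k * (\<Sum>n<N. norm (c n))) - 1 - norm k * (\<Sum>n<N. norm (c n))" for N
      using norm_prod_first_order[of "\<lambda>n. - k * c n" N]
      by (simp add: norm_mult sum_distrib_left sum_negf)
    ultimately show ?thesis by (intro LIMSEQ_le) auto
  qed
  note bound = this
  have "\<forall>\<^sub>F k in at 0. norm (((\<Prod>n. 1 - k * c n) - 1) / k - - (\<Sum>n. c n)) \<le> norm k * S\<^sup>2"
  proof -
    have "\<forall>\<^sub>F k :: complex in at 0. norm k * S < 1"
    proof (rule order_tendstoD)
      show "((\<lambda>k :: complex. norm k * S) \<longlongrightarrow> norm (0 :: complex) * S) (at 0)"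
        by (intro tendsto_intros)
    qed auto
    thus ?thesis using eventually_neq_at_within[of "0 :: complex" 0 UNIV]
    proof eventually_elim
      case (elim k)
      have "exp (norm k * S) \<le> 1 + norm k * S + (norm k * S)\<^sup>2"
        using elim S by (intro exp_bound) auto
      hence "norm ((\<Prod>n. 1 - k * c n) - 1 + k * (\<Sum>n. c n)) \<le> (norm k * S)\<^sup>2"
        using bound[of k] by simp
      moreover have "((\<Prod>n. 1 - k * c n) - 1) / k - - (\<Sum>n. c n) = ((\<Prod>n. 1 - k * c n) - 1 + k * (\<Sum>n. c n)) / k"
        using elim by (simp add: field_simps)
      ultimately show ?case using elim
        by (simp add: norm_divide field_simps power2_eq_square)
    qed
  qed
  moreover have "((\<lambda>k :: complex. norm k * S\<^sup>2) \<longlongrightarrow> 0) (at 0)"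
    by (rule tendsto_eq_intros refl)+ auto
  ultimately have "((\<lambda>k. ((\<Prod>n. 1 - k * c n) - 1) / k - - (\<Sum>n. c n)) \<longlongrightarrow> 0) (at 0)"
    by (rule Lim_null_comparison)
  thus ?thesis by (rule LIM_zero_cancel)
qed

text \<open>With x = b q^n and k = (v - 1)^2 / v one has (1 - x v)(1 - x / v) = (1 - x)^2 (1 - k x /
  (1 - x)^2). The last coefficient is this term; summed over the lattice it gives the Weierstrass
  function in multiplicative coordinates.\<close>

definition lambert_term :: "complex \<Rightarrow> complex \<Rightarrow> nat \<Rightarrow> complex" where
  "lambert_term q b n = b * q ^ n / (1 - b * q ^ n)\<^sup>2"

lemma summable_lambert_term:
  assumes "norm q < 1"
  shows "summable (\<lambda>n. norm (lambert_term q b n))"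
proof -
  have "(\<lambda>n. 1 / (1 - b * q ^ n)\<^sup>2) \<longlonglongrightarrow> 1 / (1 - b * 0)\<^sup>2"
    using assms by (intro tendsto_intros LIMSEQ_power_zero) auto
  then obtain K where K: "K > 0" "\<And>n. norm (1 / (1 - b * q ^ n)\<^sup>2) \<le> K"
    using convergent_imp_Bseq[of "\<lambda>n. 1 / (1 - b * q ^ n)\<^sup>2"] by (auto simp: convergent_def Bseq_def)
  show ?thesis
  proof (rule summable_comparison_test')
    show "summable (\<lambda>n. norm b * K * norm q ^ n)"
      using assms by (intro summable_mult summable_geometric) auto
    fix n :: nat
    have "norm (lambert_term q b n) = norm b * norm q ^ n * norm (1 / (1 - b * q ^ n)\<^sup>2)"
      by (simp add: lambert_term_def norm_divide norm_mult norm_power)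
    also have "\<dots> \<le> norm b * norm q ^ n * K"
      by (intro mult_left_mono K) auto
    finally show "norm (norm (lambert_term q b n)) \<le> norm b * K * norm q ^ n"
      by (simp add: mult_ac)
  qed
qed

definition lambert_prod :: "complex \<Rightarrow> complex \<Rightarrow> complex \<Rightarrow> complex" where
  "lambert_prod q b k = (\<Prod>n. 1 - k * lambert_term q b n)"

text \<open>The left side is invariant under v -> 1/v and depends on \<open>v\<close> only through
  (v - 1)^2 / v. A second-order expansion at v = 1 thereby becomes a first-order one in that
  parameter.\<close>

lemma qpoch_mult_split:
  assumes q: "norm q < 1" and v: "v \<noteq> 0" and b: "qpoch b q \<noteq> 0"
  shows "qpoch (b * v) q * qpoch (b / v) q = (qpoch b q)\<^sup>2 * lambert_prod q b ((v - 1)\<^sup>2 / v)"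
proof -
  define k where "k = (v - 1)\<^sup>2 / v"
  have "abs_convergent_prod (\<lambda>n. 1 - k * lambert_term q b n)"
    using summable_lambert_term[OF q, of b]
    by (intro summable_imp_abs_convergent_prod) (auto simp: norm_mult intro: summable_mult)
  hence "(\<lambda>n. 1 - k * lambert_term q b n) has_prod lambert_prod q b k"
    unfolding lambert_prod_def by (intro convergent_prod_has_prod abs_convergent_prod_imp_convergent_prod)
  hence "(\<lambda>N. \<Prod>n<N. 1 - k * lambert_term q b n) \<longlonglongrightarrow> lambert_prod q b k"
    by (rule has_prod_imp_tendsto')
  hence "(\<lambda>N. (\<Prod>n<N. 1 - b * q ^ n)\<^sup>2 * (\<Prod>n<N. 1 - k * lambert_term q b n)) \<longlonglongrightarrow> (qpoch b q)\<^sup>2 * lambert_prod q b k"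
    by (intro tendsto_intros qpoch_LIMSEQ q)
  also have "(\<lambda>N. (\<Prod>n<N. 1 - b * q ^ n)\<^sup>2 * (\<Prod>n<N. 1 - k * lambert_term q b n))
     = (\<lambda>N. (\<Prod>n<N. 1 - b * v * q ^ n) * (\<Prod>n<N. 1 - b / v * q ^ n))"
  proof (rule ext)
    fix N
    have "(1 - b * q ^ n)\<^sup>2 * (1 - k * lambert_term q b n) = (1 - b * v * q ^ n) * (1 - b / v * q ^ n)" for n
    proof -
      define x where "x = b * q ^ n"
      have "x \<noteq> 1" using b qpoch_eq_0_iff[OF q, of b] by (auto simp: x_def)
      have "(1 - x)\<^sup>2 * (1 - k * (x / (1 - x)\<^sup>2)) = (1 - x)\<^sup>2 - k * x"
        using \<open>x \<noteq> 1\<close> by (simp add: right_diff_distrib)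
      also have "\<dots> = (1 - x * v) * (1 - x / v)"
        using v by (simp add: k_def field_simps power2_eq_square)
      finally show ?thesis by (simp add: x_def lambert_term_def mult_ac)
    qed
    thus "(\<Prod>n<N. 1 - b * q ^ n)\<^sup>2 * (\<Prod>n<N. 1 - k * lambert_term q b n)
       = (\<Prod>n<N. 1 - b * v * q ^ n) * (\<Prod>n<N. 1 - b / v * q ^ n)"
      by (simp add: prod_power_distrib flip: prod.distrib)
  qed
  finally have "(\<lambda>N. (\<Prod>n<N. 1 - b * v * q ^ n) * (\<Prod>n<N. 1 - b / v * q ^ n)) \<longlonglongrightarrow> (qpoch b q)\<^sup>2 * lambert_prod q b k" .
  moreover have "(\<lambda>N. (\<Prod>n<N. 1 - b * v * q ^ n) * (\<Prod>n<N. 1 - b / v * q ^ n)) \<longlonglongrightarrow> qpoch (b * v) q * qpoch (b / v) q"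
    by (intro tendsto_intros qpoch_LIMSEQ q)
  ultimately show ?thesis unfolding k_def by (rule LIMSEQ_unique[OF _ , symmetric])
qed

lemma jtheta_mult_split:
  assumes q: "norm q < 1" and v: "v \<noteq> 0" and a: "jtheta a q \<noteq> 0"
  shows "jtheta (a * v) q * jtheta (a / v) q
    = (jtheta a q)\<^sup>2 * (lambert_prod q a ((v - 1)\<^sup>2 / v) * lambert_prod q (q / a) ((v - 1)\<^sup>2 / v))"
proof -
  have "qpoch a q \<noteq> 0" "qpoch (q / a) q \<noteq> 0" using a by (auto simp: jtheta_def)
  from qpoch_mult_split[OF q v this(1)] qpoch_mult_split[OF q v this(2)]
  show ?thesis by (simp add: jtheta_def power_mult_distrib) (simp add: mult_ac)
qed

lemma tendsto_lambert_prod: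
  assumes "norm q < 1"
  shows "((\<lambda>k. (lambert_prod q b k - 1) / k) \<longlongrightarrow> - (\<Sum>n. lambert_term q b n)) (at 0)"
  unfolding lambert_prod_def by (rule prodinf_first_order[OF summable_lambert_term[OF assms]])

lemma tendsto_lambert_prod_1:
  assumes "norm q < 1"
  shows "(lambert_prod q b \<longlongrightarrow> 1) (at 0)"
proof -
  have "((\<lambda>k. 1 + k * ((lambert_prod q b k - 1) / k)) \<longlongrightarrow> 1 + 0 * - (\<Sum>n. lambert_term q b n)) (at 0)"
    by (intro tendsto_intros tendsto_lambert_prod assms)
  moreover have "\<forall>\<^sub>F k in at 0. 1 + k * ((lambert_prod q b k - 1) / k) = lambert_prod q b k"
    using eventually_neq_at_within[of "0 :: complex" 0 UNIV] by eventually_elim auto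
  ultimately have "(lambert_prod q b \<longlongrightarrow> 1 + 0 * - (\<Sum>n. lambert_term q b n)) (at 0)"
    by (rule Lim_transform_eventually)
  thus ?thesis by simp
qed

text \<open>
  The three-term relation at \<open>(a, b, 1, v)\<close> to second order at \<open>v = 1\<close>, where
  \<open>(v - 1)\<^sup>2 / v\<close> is the natural local parameter: this is the factorisation of a difference of
  two Weierstrass \<open>\<wp>\<close>-values.
\<close>
lemma lambert_theta:
  assumes q: "norm q < 1" "q \<noteq> 0" and nz: "jtheta a q \<noteq> 0" "jtheta b q \<noteq> 0" "a \<noteq> 0" "b \<noteq> 0"
  defines "S \<equiv> \<lambda>x. (\<Sum>n. lambert_term q x n) + (\<Sum>n. lambert_term q (q / x) n)"
  shows "S a - S b = - b * jtheta (a * b) q * jtheta (a / b) q * qpoch q q ^ 4 / (jtheta a q * jtheta b q)\<^sup>2"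
proof -
  define \<kappa> where "\<kappa> = (\<lambda>v :: complex. (v - 1)\<^sup>2 / v)"
  define W where "W = (\<lambda>x k. lambert_prod q x k * lambert_prod q (q / x) k)"
  define E where "E = qpoch q q"
  have "(\<kappa> \<longlongrightarrow> (1 - 1)\<^sup>2 / 1) (at 1)"
    unfolding \<kappa>_def by (intro tendsto_intros) auto
  moreover have ev: "\<forall>\<^sub>F v :: complex in at 1. v \<noteq> 0 \<and> v \<noteq> 1"
    by (intro eventually_conj eventually_neq_at_within)
  hence "\<forall>\<^sub>F v in at 1. \<kappa> v \<noteq> 0"
    by eventually_elim (auto simp: \<kappa>_def)
  ultimately have \<kappa>: "filterlim \<kappa> (at 0) (at 1)"
    by (simp add: filterlim_at)
  have W: "((\<lambda>k. (W x k - 1) / k) \<longlongrightarrow> - S x) (at 0)" for x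
  proof -
    have "((\<lambda>k. (lambert_prod q x k - 1) / k * lambert_prod q (q / x) k + (lambert_prod q (q / x) k - 1) / k)
        \<longlongrightarrow> - (\<Sum>n. lambert_term q x n) * 1 + - (\<Sum>n. lambert_term q (q / x) n)) (at 0)"
      by (intro tendsto_intros tendsto_lambert_prod tendsto_lambert_prod_1 q)
    moreover have "(lambert_prod q x k - 1) / k * lambert_prod q (q / x) k + (lambert_prod q (q / x) k - 1) / k = (W x k - 1) / k" for k
      by (simp add: W_def algebra_simps flip: add_divide_distrib)
    ultimately show ?thesis by (simp add: S_def)
  qed
  have eq: "- theta_pair q a b * (E ^ 4 * (lambert_prod q q (\<kappa> v))\<^sup>2)
     = (jtheta a q * jtheta b q)\<^sup>2 / (a * b) * ((W b (\<kappa> v) - 1) / \<kappa> v - (W a (\<kappa> v) - 1) / \<kappa> v)"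
    if v: "v \<noteq> 0" "v \<noteq> 1" for v
  proof -
    have k: "\<kappa> v \<noteq> 0" using v by (simp add: \<kappa>_def)
    have M: "theta_pair q x v = (jtheta x q)\<^sup>2 * W x (\<kappa> v) / x" if "jtheta x q \<noteq> 0" for x
      using jtheta_mult_split[OF q(1) v(1) that] by (simp add: theta_pair_def W_def \<kappa>_def)
    have M1: "theta_pair q x 1 = (jtheta x q)\<^sup>2 / x" for x
      by (simp add: theta_pair_def power2_eq_square)
    have E0: "E \<noteq> 0" unfolding E_def by (rule qpoch_self_nonzero[OF q(1)])
    \<comment> \<open>The simple zero of theta at \<open>v = 1\<close> is split off. Squared and
      divided by \<open>v\<close>, it yields exactly the factor \<open>\<kappa> v\<close> by which
      the relation is divided before the limit.\<close>
    have "jtheta v q = (1 - v) * (qpoch (q * v) q * qpoch (q / v) q)"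
      using qpoch_head[OF q(1), of v] by (simp add: jtheta_def mult_ac)
    also have "\<dots> = (1 - v) * (E\<^sup>2 * lambert_prod q q (\<kappa> v))"
      using qpoch_mult_split[OF q(1) v(1), of q] E0 by (simp add: E_def \<kappa>_def)
    finally have J: "jtheta v q = (1 - v) * (E\<^sup>2 * lambert_prod q q (\<kappa> v))" .
    have "(jtheta v q)\<^sup>2 / v = \<kappa> v * (E ^ 4 * (lambert_prod q q (\<kappa> v))\<^sup>2)"
      unfolding J by (simp add: \<kappa>_def power_mult_distrib power2_commute[of 1 v] flip: power_mult)
    hence M1v: "theta_pair q 1 v = - (\<kappa> v * (E ^ 4 * (lambert_prod q q (\<kappa> v))\<^sup>2))"
      using jtheta_inverse[OF q(1) v(1)] by (simp add: theta_pair_def power2_eq_square)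
    have "theta_pair q a b * theta_pair q 1 v - theta_pair q a 1 * theta_pair q b v + theta_pair q a v * theta_pair q b 1 = 0"
      using theta_three_term[OF q nz(3,4), of 1 v] v by simp
    hence "- theta_pair q a b * (E ^ 4 * (lambert_prod q q (\<kappa> v))\<^sup>2) * \<kappa> v
       = (jtheta a q * jtheta b q)\<^sup>2 / (a * b) * (W b (\<kappa> v) - W a (\<kappa> v))"
      unfolding M1v M1 M[OF nz(1)] M[OF nz(2)] by (simp add: algebra_simps power_mult_distrib diff_divide_distrib)
    hence "- theta_pair q a b * (E ^ 4 * (lambert_prod q q (\<kappa> v))\<^sup>2)
       = (jtheta a q * jtheta b q)\<^sup>2 / (a * b) * (W b (\<kappa> v) - W a (\<kappa> v)) / \<kappa> v"
      using k by (subst nonzero_eq_divide_eq)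
    moreover have "(W b (\<kappa> v) - 1) / \<kappa> v - (W a (\<kappa> v) - 1) / \<kappa> v = (W b (\<kappa> v) - W a (\<kappa> v)) / \<kappa> v"
      by (simp add: diff_divide_distrib)
    ultimately show ?thesis by simp
  qed
  have lim1: "((\<lambda>v. - theta_pair q a b * (E ^ 4 * (lambert_prod q q (\<kappa> v))\<^sup>2)) \<longlongrightarrow> - theta_pair q a b * (E ^ 4 * 1\<^sup>2)) (at 1)"
    by (intro tendsto_intros filterlim_compose[OF tendsto_lambert_prod_1[OF q(1)] \<kappa>])
  have lim2: "((\<lambda>v. (jtheta a q * jtheta b q)\<^sup>2 / (a * b) * ((W b (\<kappa> v) - 1) / \<kappa> v - (W a (\<kappa> v) - 1) / \<kappa> v))
      \<longlongrightarrow> (jtheta a q * jtheta b q)\<^sup>2 / (a * b) * (- S b - - S a)) (at 1)"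
    by (intro tendsto_intros filterlim_compose[OF W \<kappa>])
  have ev': "\<forall>\<^sub>F v in at 1. - theta_pair q a b * (E ^ 4 * (lambert_prod q q (\<kappa> v))\<^sup>2)
     = (jtheta a q * jtheta b q)\<^sup>2 / (a * b) * ((W b (\<kappa> v) - 1) / \<kappa> v - (W a (\<kappa> v) - 1) / \<kappa> v)"
    using ev by eventually_elim (use eq in auto)
  have "- theta_pair q a b * (E ^ 4 * 1\<^sup>2) = (jtheta a q * jtheta b q)\<^sup>2 / (a * b) * (- S b - - S a)"
    by (rule tendsto_unique[OF at_neq_bot Lim_transform_eventually[OF lim1 ev'] lim2])
  hence "- theta_pair q a b * E ^ 4 = (jtheta a q * jtheta b q)\<^sup>2 / (a * b) * (S a - S b)"
    by simp
  thus ?thesis using nz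
    by (simp add: theta_pair_def E_def field_simps)
qed

section \<open>The Lambert series of the quadratic character modulo 5\<close>

definition chi5 :: "nat \<Rightarrow> real" where
  "chi5 k = (if k mod 5 = 1 \<or> k mod 5 = 4 then 1 else if k mod 5 = 2 \<or> k mod 5 = 3 then -1 else 0)"

lemma abs_chi5_le_1: "\<bar>chi5 k\<bar> \<le> 1"
  by (simp add: chi5_def)

lemma sums_of_nat_power:
  fixes y :: "'a::{real_normed_field,banach}"
  assumes "norm y < 1"
  shows "(\<lambda>k. of_nat k * y ^ k) sums (y / (1 - y)\<^sup>2)"
proof -
  have "(\<lambda>k. y * (of_nat (Suc k) * y ^ k)) sums (y * (1 / (1 - y)\<^sup>2))"
    by (intro sums_mult geometric_deriv_sums assms)
  hence "(\<lambda>k. of_nat (Suc k) * y ^ Suc k) sums (y / (1 - y)\<^sup>2)"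
    by (simp add: mult_ac)
  thus ?thesis using sums_Suc[of "\<lambda>k. of_nat k * y ^ k"] by simp
qed

text \<open>Separability of the Gauss sum of a primitive character. The values at \<open>k\<close>
  prime to 5 only permute the four powers of \<open>w\<close>.\<close>

lemma gauss_sum_chi5:
  fixes w :: complex
  assumes w: "w ^ 4 + w ^ 3 + w\<^sup>2 + w + 1 = 0"
  shows "w ^ k + (w ^ 4) ^ k - (w\<^sup>2) ^ k - (w ^ 3) ^ k = (w + w ^ 4 - w\<^sup>2 - w ^ 3) * of_real (chi5 k)"
proof -
  have w5: "w ^ 5 = 1" using w by algebra
  have red: "w ^ (j * k) = w ^ (j * (k mod 5))" for j
  proof -
    have "w ^ (j * k) = w ^ (j * (k mod 5)) * (w ^ 5) ^ (j * (k div 5))"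
      by (metis (no_types, lifting) add.commute distrib_left mult.left_commute mult_div_mod_eq power_add power_mult)
    thus ?thesis by (simp add: w5)
  qed
  have "k mod 5 < 5" by simp
  then consider "k mod 5 = 0" | "k mod 5 = 1" | "k mod 5 = 2" | "k mod 5 = 3" | "k mod 5 = 4" by linarith
  thus ?thesis
  proof cases
    case 1
    thus ?thesis using red[of 1] red[of 2] red[of 3] red[of 4] by (simp add: chi5_def flip: power_mult)
  next
    case 2
    thus ?thesis using red[of 1] red[of 2] red[of 3] red[of 4] by (simp add: chi5_def flip: power_mult)
  next
    case 3
    have "w\<^sup>2 + w ^ 8 - w ^ 4 - w ^ 6 = - (w + w ^ 4 - w\<^sup>2 - w ^ 3)" using w5 by algebra
    thus ?thesis using 3 red[of 1] red[of 2] red[of 3] red[of 4] by (simp add: chi5_def flip: power_mult)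
  next
    case 4
    have "w ^ 3 + w ^ 12 - w ^ 6 - w ^ 9 = - (w + w ^ 4 - w\<^sup>2 - w ^ 3)" using w5 by algebra
    thus ?thesis using 4 red[of 1] red[of 2] red[of 3] red[of 4] by (simp add: chi5_def flip: power_mult)
  next
    case 5
    have "w ^ 4 + w ^ 16 - w ^ 8 - w ^ 12 = w + w ^ 4 - w\<^sup>2 - w ^ 3" using w5 by algebra
    thus ?thesis using 5 red[of 1] red[of 2] red[of 3] red[of 4] by (simp add: chi5_def flip: power_mult)
  qed
qed

lemma qpoch_fifth_roots:
  fixes q w :: complex
  assumes "norm q < 1" "w ^ 4 + w ^ 3 + w\<^sup>2 + w + 1 = 0"
  shows "qpoch z q * qpoch (w * z) q * qpoch (w\<^sup>2 * z) q * qpoch (w ^ 3 * z) q * qpoch (w ^ 4 * z) q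
    = qpoch (z ^ 5) (q ^ 5)"
proof -
  have "norm (q ^ 5) < 1" using assms by (simp add: norm_power power_less_one_iff)
  have "(\<lambda>N. (\<Prod>n<N. 1 - z * q ^ n) * (\<Prod>n<N. 1 - w * z * q ^ n) * (\<Prod>n<N. 1 - w\<^sup>2 * z * q ^ n)
        * (\<Prod>n<N. 1 - w ^ 3 * z * q ^ n) * (\<Prod>n<N. 1 - w ^ 4 * z * q ^ n))
      \<longlonglongrightarrow> qpoch z q * qpoch (w * z) q * qpoch (w\<^sup>2 * z) q * qpoch (w ^ 3 * z) q * qpoch (w ^ 4 * z) q"
    by (intro tendsto_mult qpoch_LIMSEQ assms)
  also have "(\<lambda>N. (\<Prod>n<N. 1 - z * q ^ n) * (\<Prod>n<N. 1 - w * z * q ^ n) * (\<Prod>n<N. 1 - w\<^sup>2 * z * q ^ n)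
        * (\<Prod>n<N. 1 - w ^ 3 * z * q ^ n) * (\<Prod>n<N. 1 - w ^ 4 * z * q ^ n))
    = (\<lambda>N. \<Prod>n<N. 1 - z ^ 5 * (q ^ 5) ^ n)"
  proof (rule ext)
    fix N
    have "(1 - a) * (1 - w * a) * (1 - w\<^sup>2 * a) * (1 - w ^ 3 * a) * (1 - w ^ 4 * a) = 1 - a ^ 5" for a
      using assms(2) by algebra
    from this[of "z * q ^ n" for n]
    have "(1 - z * q ^ n) * (1 - w * z * q ^ n) * (1 - w\<^sup>2 * z * q ^ n) * (1 - w ^ 3 * z * q ^ n)
        * (1 - w ^ 4 * z * q ^ n) = 1 - (z * q ^ n) ^ 5" for n
      by (simp only: mult.assoc)
    moreover have "(z * q ^ n) ^ 5 = z ^ 5 * (q ^ 5) ^ n" for n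
      by (simp add: power_mult_distrib mult.commute flip: power_mult)
    ultimately have "(1 - z * q ^ n) * (1 - w * z * q ^ n) * (1 - w\<^sup>2 * z * q ^ n) * (1 - w ^ 3 * z * q ^ n)
        * (1 - w ^ 4 * z * q ^ n) = 1 - z ^ 5 * (q ^ 5) ^ n" for n
      by simp
    thus "(\<Prod>n<N. 1 - z * q ^ n) * (\<Prod>n<N. 1 - w * z * q ^ n) * (\<Prod>n<N. 1 - w\<^sup>2 * z * q ^ n)
        * (\<Prod>n<N. 1 - w ^ 3 * z * q ^ n) * (\<Prod>n<N. 1 - w ^ 4 * z * q ^ n)
      = (\<Prod>n<N. 1 - z ^ 5 * (q ^ 5) ^ n)"
      by (simp flip: prod.distrib)
  qed
  finally show ?thesis
    using LIMSEQ_unique qpoch_LIMSEQ[OF \<open>norm (q ^ 5) < 1\<close>] by blast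
qed

text \<open>\<open>lambert_theta\<close> at the fifth roots of unity \<open>w\<close> and
  \<open>w^2\<close>. On the left, the expansion of y / (1 - y)^2 as the sum of k y^k and the Gauss
  sum \<open>s\<close> turn four Lambert series into one with the character. On the right, the
  products at the nontrivial roots combine with \<open>qpoch q q\<close> to the product in base
  \<open>q ^ 5\<close>.\<close>

lemma lambert_chi5_complex:
  fixes q :: complex
  assumes q: "norm q < 1" "q \<noteq> 0"
  shows "(\<lambda>n. \<Sum>k. of_real (of_nat k * chi5 k) * (q ^ Suc n) ^ k) sums ((1 - qpoch q q ^ 5 / qpoch (q ^ 5) (q ^ 5)) / 5)"
proof -
  define w where "w = cis (2 * pi / 5)"
  have w5: "w ^ 5 = 1" by (simp add: w_def Complex.DeMoivre)
  have "w \<noteq> 1"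
  proof
    assume "w = 1"
    hence "cos (2 * pi / 5) = cos 0" by (simp add: w_def complex_eq_iff)
    moreover have "cos (2 * pi / 5) < cos 0" by (rule cos_monotone_0_pi) auto
    ultimately show False by simp
  qed
  moreover have "(w - 1) * (w ^ 4 + w ^ 3 + w\<^sup>2 + w + 1) = 0" using w5 by algebra
  ultimately have w: "w ^ 4 + w ^ 3 + w\<^sup>2 + w + 1 = 0" by simp
  have nw: "norm w = 1" by (simp add: w_def)
  have w0: "w \<noteq> 0" using nw by auto
  define s where "s = w + w ^ 4 - w\<^sup>2 - w ^ 3"
  have s2: "s\<^sup>2 = 5" unfolding s_def using w by algebra
  have s0: "s \<noteq> 0" using s2 by auto
  have q5: "norm (q ^ 5) < 1" using q by (simp add: norm_power power_less_one_iff)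
  define E E5 where "E = qpoch q q" and "E5 = qpoch (q ^ 5) (q ^ 5)"
  have E0: "E \<noteq> 0" "E5 \<noteq> 0" unfolding E_def E5_def using q(1) q5 by (simp_all add: qpoch_self_nonzero)
  have inv: "x / w = w ^ 4 * x" "x / w\<^sup>2 = w ^ 3 * x" for x
    using w0 w5 by (simp_all add: field_simps flip: power_Suc power_Suc2 power_add)
  define A B where "A = qpoch (w * q) q * qpoch (w ^ 4 * q) q" and "B = qpoch (w\<^sup>2 * q) q * qpoch (w ^ 3 * q) q"
  have "E * (A * B) = E5"
    using qpoch_fifth_roots[OF q(1) w, of q] by (simp add: A_def B_def E_def E5_def mult_ac)
  hence AB: "A * B = E5 / E" using E0 by (simp add: field_simps)
  have th1: "jtheta w q = (1 - w) * A"
    using qpoch_head[OF q(1), of w] by (simp add: jtheta_def A_def inv mult_ac)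
  have th2: "jtheta (w\<^sup>2) q = (1 - w\<^sup>2) * B"
    using qpoch_head[OF q(1), of "w\<^sup>2"] by (simp add: jtheta_def B_def inv mult_ac)
  have "w\<^sup>2 \<noteq> 1"
  proof
    assume "w\<^sup>2 = 1"
    hence "w ^ 5 = w" by (simp add: eval_nat_numeral)
    thus False using w5 \<open>w \<noteq> 1\<close> by simp
  qed
  hence th0: "jtheta w q \<noteq> 0" "jtheta (w\<^sup>2) q \<noteq> 0"
    using AB E0 \<open>w \<noteq> 1\<close> unfolding th1 th2 by auto
  define S where "S = (\<lambda>x. (\<Sum>n. lambert_term q x n) + (\<Sum>n. lambert_term q (q / x) n))"
  have "S w - S (w\<^sup>2) = - (w\<^sup>2) * jtheta (w * w\<^sup>2) q * jtheta (w / w\<^sup>2) q * E ^ 4 / (jtheta w q * jtheta (w\<^sup>2) q)\<^sup>2"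
    unfolding S_def E_def by (rule lambert_theta) (use q th0 w0 in auto)
  \<comment> \<open>Product and quotient of the two points are again inverses of these points, so
    the numerator cancels one power of the squared denominator.\<close>
  also have "w * w\<^sup>2 = 1 / w\<^sup>2"
    using inv(2)[of 1] by (simp add: eval_nat_numeral)
  also have "w / w\<^sup>2 = 1 / w"
    by (simp add: power2_eq_square)
  also have "jtheta (1 / w\<^sup>2) q = - jtheta (w\<^sup>2) q / w\<^sup>2"
    using jtheta_inverse[OF q(1)] w0 by simp
  also have "jtheta (1 / w) q = - jtheta w q / w"
    using jtheta_inverse[OF q(1)] w0 by simp
  also have "- (w\<^sup>2) * (- jtheta (w\<^sup>2) q / w\<^sup>2) * (- jtheta w q / w) * E ^ 4 / (jtheta w q * jtheta (w\<^sup>2) q)\<^sup>2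
      = - (E ^ 4 / (w * (jtheta w q * jtheta (w\<^sup>2) q)))"
    using th0 w0 by (simp add: field_simps power2_eq_square)
  also have "w * (jtheta w q * jtheta (w\<^sup>2) q) = (w * (1 - w) * (1 - w\<^sup>2)) * (A * B)"
    by (simp add: th1 th2)
  \<comment> \<open>The heads of the two theta functions multiply to the Gauss sum itself, so both
    sides carry the factor \<open>s\<close>, by \<open>s\<^sup>2 = 5\<close>.\<close>
  also have "w * (1 - w) * (1 - w\<^sup>2) = s"
    unfolding s_def by (simp add: algebra_simps eval_nat_numeral)
  also have "- (E ^ 4 / (s * (A * B))) = - s / 5 * (E ^ 5 / E5)"
  proof -
    have "1 / s = s / 5" using s0 s2 by (simp add: field_simps power2_eq_square)
    moreover have "E ^ 4 / (s * (A * B)) = 1 / s * (E ^ 4 / (A * B))" by simp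
    ultimately have "E ^ 4 / (s * (A * B)) = s / 5 * (E ^ 4 / (A * B))" by (simp only:)
    thus ?thesis using E0 by (simp add: AB eval_nat_numeral)
  qed
  finally have SS: "S w - S (w\<^sup>2) = - s / 5 * (E ^ 5 / E5)" .
  define f where "f = (\<lambda>x n. lambert_term q (x * q) n)"
  have f: "f x sums (\<Sum>n. f x n)" for x
    unfolding f_def by (rule summable_sums[OF summable_norm_cancel[OF summable_lambert_term[OF q(1)]]])
  \<comment> \<open>Splitting off the term n = 0 at \<open>x\<close> makes both series run over
    positive powers of \<open>q\<close>; the heads later give the constant 1/5.\<close>
  have S': "S x = x / (1 - x)\<^sup>2 + (\<Sum>n. f x n) + (\<Sum>n. f (1 / x) n)" for x
  proof -
    have "(\<Sum>n. lambert_term q x n) = (\<Sum>n. lambert_term q x (Suc n)) + lambert_term q x 0"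
      using suminf_split_head[OF summable_norm_cancel[OF summable_lambert_term[OF q(1)]], of x] by simp
    moreover have "lambert_term q x (Suc n) = f x n" for n
      by (simp add: lambert_term_def f_def mult_ac)
    ultimately show ?thesis by (simp add: S_def f_def lambert_term_def)
  qed
  have inv1: "1 / w = w ^ 4" "1 / w\<^sup>2 = w ^ 3" using inv[of 1] by simp_all
  have "(\<lambda>n. f w n + f (w ^ 4) n - f (w\<^sup>2) n - f (w ^ 3) n) sums
     ((\<Sum>n. f w n) + (\<Sum>n. f (w ^ 4) n) - (\<Sum>n. f (w\<^sup>2) n) - (\<Sum>n. f (w ^ 3) n))"
    by (intro sums_add sums_diff f)
  also have "(\<Sum>n. f w n) + (\<Sum>n. f (w ^ 4) n) - (\<Sum>n. f (w\<^sup>2) n) - (\<Sum>n. f (w ^ 3) n)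
     = S w - S (w\<^sup>2) - (w / (1 - w)\<^sup>2 - w\<^sup>2 / (1 - w\<^sup>2)\<^sup>2)"
    by (simp add: S' inv1)
  also have "w / (1 - w)\<^sup>2 - w\<^sup>2 / (1 - w\<^sup>2)\<^sup>2 = - s / 5"
  proof -
    have "5 * (w * (1 - w\<^sup>2)\<^sup>2 - w\<^sup>2 * (1 - w)\<^sup>2) = - s * ((1 - w)\<^sup>2 * (1 - w\<^sup>2)\<^sup>2)"
      unfolding s_def using w by algebra
    thus ?thesis using \<open>w \<noteq> 1\<close> \<open>w\<^sup>2 \<noteq> 1\<close> by (simp add: field_simps)
  qed
  also have "S w - S (w\<^sup>2) - (- s / 5) = s * ((1 - E ^ 5 / E5) / 5)"
    by (simp add: SS field_simps)
  also have "(\<lambda>n. f w n + f (w ^ 4) n - f (w\<^sup>2) n - f (w ^ 3) n)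
     = (\<lambda>n. s * (\<Sum>k. of_real (of_nat k * chi5 k) * (q ^ Suc n) ^ k))"
  proof (rule ext)
    fix n
    define x where "x = q ^ Suc n"
    have x: "norm x < 1" using q by (simp add: x_def norm_power power_less_one_iff del: power_Suc)
    have fx: "f (w ^ j) n = w ^ j * x / (1 - w ^ j * x)\<^sup>2" for j
      by (simp add: f_def lambert_term_def x_def mult_ac)
    have sm: "(\<lambda>k. of_nat k * (w ^ j * x) ^ k) sums f (w ^ j) n" for j
      unfolding fx using x nw by (intro sums_of_nat_power) (simp add: norm_mult norm_power)
    have "(\<lambda>k. of_nat k * (w ^ 1 * x) ^ k + of_nat k * (w ^ 4 * x) ^ k - of_nat k * (w ^ 2 * x) ^ k - of_nat k * (w ^ 3 * x) ^ k)
        sums (f (w ^ 1) n + f (w ^ 4) n - f (w ^ 2) n - f (w ^ 3) n)"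
      by (intro sums_add sums_diff sm)
    also have "(\<lambda>k. of_nat k * (w ^ 1 * x) ^ k + of_nat k * (w ^ 4 * x) ^ k - of_nat k * (w ^ 2 * x) ^ k - of_nat k * (w ^ 3 * x) ^ k)
       = (\<lambda>k. s * (of_real (of_nat k * chi5 k) * x ^ k))"
    proof (rule ext)
      fix k
      have "of_nat k * (w ^ 1 * x) ^ k + of_nat k * (w ^ 4 * x) ^ k - of_nat k * (w ^ 2 * x) ^ k - of_nat k * (w ^ 3 * x) ^ k
         = of_nat k * x ^ k * (w ^ k + (w ^ 4) ^ k - (w\<^sup>2) ^ k - (w ^ 3) ^ k)"
        by (simp add: power_mult_distrib algebra_simps)
      thus "of_nat k * (w ^ 1 * x) ^ k + of_nat k * (w ^ 4 * x) ^ k - of_nat k * (w ^ 2 * x) ^ k - of_nat k * (w ^ 3 * x) ^ k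
         = s * (of_real (of_nat k * chi5 k) * x ^ k)"
        unfolding gauss_sum_chi5[OF w] s_def[symmetric] by simp
    qed
    finally have "(\<lambda>k. s * (of_real (of_nat k * chi5 k) * x ^ k)) sums (f w n + f (w ^ 4) n - f (w\<^sup>2) n - f (w ^ 3) n)"
      by simp
    hence "(\<Sum>k. s * (of_real (of_nat k * chi5 k) * x ^ k)) = f w n + f (w ^ 4) n - f (w\<^sup>2) n - f (w ^ 3) n"
      "summable (\<lambda>k. s * (of_real (of_nat k * chi5 k) * x ^ k))"
      by (simp_all add: sums_iff)
    moreover from this(2) have "summable (\<lambda>k. of_real (of_nat k * chi5 k) * x ^ k)"
      using s0 by (subst (asm) summable_cmult_iff) auto
    ultimately show "f w n + f (w ^ 4) n - f (w\<^sup>2) n - f (w ^ 3) n = s * (\<Sum>k. of_real (of_nat k * chi5 k) * (q ^ Suc n) ^ k)"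
      by (simp only: suminf_mult x_def)
  qed
  finally show ?thesis
    unfolding sums_mult_iff[OF s0] E_def E5_def .
qed

text \<open>Together with \<open>rr_y\<close> below, one of the two weight two Eisenstein series of
  level 5 with quadratic character that are eta quotients.\<close>

definition rr_x :: "real \<Rightarrow> real" where
  "rr_x q = euler_f q ^ 5 / euler_f (q ^ 5)"

lemma chi5_0 [simp]: "chi5 0 = 0"
  by (simp add: chi5_def)

lemma lambert_chi5_double_sum:
  fixes q :: real
  assumes q: "0 < q" "q < 1"
  shows "(\<lambda>(k, n). of_nat k * chi5 k * (q ^ Suc n) ^ k) summable_on UNIV"
proof -
  have geo: "((\<lambda>n. \<bar>of_nat k * chi5 k * (q ^ Suc n) ^ k\<bar>) has_sum (real k * \<bar>chi5 k\<bar> * (q ^ k / (1 - q ^ k)))) UNIV" for k :: nat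
  proof (cases "k = 0")
    case False
    hence qk: "q ^ k < 1" using q by (simp add: power_less_one_iff)
    have "(\<lambda>n. real k * \<bar>chi5 k\<bar> * (q ^ k * (q ^ k) ^ n)) sums (real k * \<bar>chi5 k\<bar> * (q ^ k * (1 / (1 - q ^ k))))"
      using q qk by (intro sums_mult geometric_sums) auto
    hence "(\<lambda>n. real k * \<bar>chi5 k\<bar> * (q ^ k * (q ^ k) ^ n)) sums (real k * \<bar>chi5 k\<bar> * (q ^ k / (1 - q ^ k)))"
      by simp
    moreover have "\<bar>of_nat k * chi5 k * (q ^ Suc n) ^ k\<bar> = real k * \<bar>chi5 k\<bar> * (q ^ k * (q ^ k) ^ n)" for n
      using q by (simp add: abs_mult power_mult_distrib mult.commute flip: power_mult)
    moreover have "real k * \<bar>chi5 k\<bar> * (q ^ k * (q ^ k) ^ n) \<ge> 0" for n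
      using q by (intro mult_nonneg_nonneg) auto
    ultimately show ?thesis
      by (simp only:) (rule sums_nonneg_imp_has_sum)
  qed simp
  have "(\<lambda>k. real k * \<bar>chi5 k\<bar> * (q ^ k / (1 - q ^ k))) summable_on UNIV"
  proof (rule summable_nonneg_imp_summable_on)
    have "summable (\<lambda>k. real k * q ^ k)"
      using sums_of_nat_power[of q] q by (auto simp: sums_iff)
    hence "summable (\<lambda>k. 1 / (1 - q) * (real k * q ^ k))"
      by (rule summable_mult)
    thus "summable (\<lambda>k. real k * \<bar>chi5 k\<bar> * (q ^ k / (1 - q ^ k)))"
    proof (rule summable_comparison_test')
      fix k :: nat
      show "norm (real k * \<bar>chi5 k\<bar> * (q ^ k / (1 - q ^ k))) \<le> 1 / (1 - q) * (real k * q ^ k)"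
      proof (cases "k = 0")
        case False
        have qk: "q ^ k \<le> q" using q False power_decreasing[of 1 k q] by simp
        have "q ^ k / (1 - q ^ k) \<le> q ^ k / (1 - q)"
          using q qk by (intro divide_left_mono mult_pos_pos) auto
        moreover have "q ^ k / (1 - q ^ k) \<ge> 0" using q qk by (intro divide_nonneg_nonneg) auto
        ultimately have "real k * \<bar>chi5 k\<bar> * (q ^ k / (1 - q ^ k)) \<le> real k * 1 * (q ^ k / (1 - q))"
          using q by (intro mult_mono abs_chi5_le_1 mult_nonneg_nonneg) auto
        moreover have "norm (real k * \<bar>chi5 k\<bar> * (q ^ k / (1 - q ^ k))) = real k * \<bar>chi5 k\<bar> * (q ^ k / (1 - q ^ k))"
          unfolding real_norm_def using \<open>q ^ k / (1 - q ^ k) \<ge> 0\<close> by (intro abs_of_nonneg mult_nonneg_nonneg) auto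
        ultimately show ?thesis by (simp add: mult_ac)
      qed simp
    qed
  qed (use q in \<open>auto intro!: mult_nonneg_nonneg divide_nonneg_nonneg power_le_one\<close>)
  moreover have "\<bar>real k * \<bar>chi5 k\<bar> * (q ^ k / (1 - q ^ k))\<bar> = real k * \<bar>chi5 k\<bar> * (q ^ k / (1 - q ^ k))" for k
    using q by (intro abs_of_nonneg mult_nonneg_nonneg divide_nonneg_nonneg) (auto simp: power_le_one)
  ultimately have "(\<lambda>x. norm (case x of (k, n) \<Rightarrow> of_nat k * chi5 k * (q ^ Suc n) ^ k)) summable_on (UNIV \<times> UNIV)"
    unfolding Infinite_Sum.abs_summable_on_Sigma_iff
    by (simp del: power_Suc add: infsumI[OF geo] has_sum_imp_summable[OF geo])
  hence "(\<lambda>(k, n). of_nat k * chi5 k * (q ^ Suc n) ^ k) summable_on (UNIV \<times> UNIV)"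
    by (rule abs_summable_summable)
  thus ?thesis by simp
qed

text \<open>Exchanging the two summations, justified by absolute summability, lets the geometric
  series over \<open>n\<close> be summed and gives the form that termwise differentiation of the
  logarithm produces.\<close>

lemma lambert_chi5:
  fixes q :: real
  assumes q: "0 < q" "q < 1"
  shows "(\<lambda>k. of_nat k * chi5 k * (q ^ k / (1 - q ^ k))) sums ((1 - rr_x q) / 5)"
proof -
  define g where "g = (\<lambda>k n. of_nat k * chi5 k * (q ^ Suc n) ^ k)"
  have S: "(\<lambda>(k, n). g k n) summable_on (UNIV \<times> UNIV)"
    using lambert_chi5_double_sum[OF q] by (simp add: g_def)
  have rows: "((\<lambda>n. g k n) has_sum (of_nat k * chi5 k * (q ^ k / (1 - q ^ k)))) UNIV" for k :: nat
  proof (cases "k = 0")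
    case False
    hence qk: "q ^ k < 1" using q by (simp add: power_less_one_iff)
    have "(\<lambda>n. (q ^ k) * (q ^ k) ^ n) sums ((q ^ k) * (1 / (1 - q ^ k)))"
      using q qk by (intro sums_mult geometric_sums) auto
    hence "((\<lambda>n. (q ^ k) * (q ^ k) ^ n) has_sum (q ^ k / (1 - q ^ k))) UNIV"
      using q by (intro sums_nonneg_imp_has_sum) auto
    moreover have "g k n = of_nat k * chi5 k * ((q ^ k) * (q ^ k) ^ n)" for n
      by (simp add: g_def power_mult_distrib mult.commute flip: power_mult)
    ultimately show ?thesis
      using has_sum_cmult_right[of "\<lambda>n. (q ^ k) * (q ^ k) ^ n" UNIV "q ^ k / (1 - q ^ k)" "real k * chi5 k"] by simp
  qed (simp add: g_def)
  have "\<bar>q\<bar> < 1" "\<bar>q ^ 5\<bar> < 1" using q by (simp_all add: power_less_one_iff)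
  have "((\<lambda>k. of_nat k * chi5 k * (q ^ k / (1 - q ^ k))) has_sum (\<Sum>\<^sub>\<infinity>(k, n)\<in>UNIV \<times> UNIV. g k n)) UNIV"
    by (rule has_sum_SigmaD[OF has_sum_infsum[OF S]]) (use rows in auto)
  hence 1: "(\<lambda>k. of_nat k * chi5 k * (q ^ k / (1 - q ^ k))) sums (\<Sum>\<^sub>\<infinity>(k, n)\<in>UNIV \<times> UNIV. g k n)"
    by (rule has_sum_imp_sums)
  have S': "(\<lambda>(n, k). g k n) summable_on (UNIV \<times> UNIV)"
    using S by (subst summable_on_swap) simp
  have cols: "((\<lambda>k. g k n) has_sum (\<Sum>k. g k n)) UNIV" for n
  proof -
    have "(\<lambda>k. g k n) summable_on UNIV"
      using summable_on_SigmaD1[OF S', of n] by simp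
    thus ?thesis using has_sum_imp_sums has_sum_infsum sums_unique by metis
  qed
  have "((\<lambda>n. \<Sum>k. g k n) has_sum (\<Sum>\<^sub>\<infinity>(n, k)\<in>UNIV \<times> UNIV. g k n)) UNIV"
    by (rule has_sum_SigmaD[OF has_sum_infsum[OF S']]) (use cols in auto)
  hence "(\<lambda>n. \<Sum>k. g k n) sums (\<Sum>\<^sub>\<infinity>(n, k)\<in>UNIV \<times> UNIV. g k n)"
    by (rule has_sum_imp_sums)
  moreover have "(\<Sum>\<^sub>\<infinity>(n, k)\<in>UNIV \<times> UNIV. g k n) = (\<Sum>\<^sub>\<infinity>(k, n)\<in>UNIV \<times> UNIV. g k n)"
    using infsum_swap_banach[OF S] infsum_Sigma'_banach[OF S] infsum_Sigma'_banach[OF S'] by simp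
  moreover have "(\<lambda>n. \<Sum>k. g k n) sums ((1 - rr_x q) / 5)"
  proof -
    have "(\<lambda>n. \<Sum>k. of_real (of_nat k * chi5 k) * (complex_of_real q ^ Suc n) ^ k) sums of_real ((1 - rr_x q) / 5)"
      using lambert_chi5_complex[of "complex_of_real q"] q \<open>\<bar>q\<bar> < 1\<close> \<open>\<bar>q ^ 5\<bar> < 1\<close>
      by (simp add: rr_x_def euler_f_def of_real_qpoch)
    moreover have "(\<Sum>k. of_real (of_nat k * chi5 k) * (complex_of_real q ^ Suc n) ^ k) = of_real (\<Sum>k. g k n)" for n
    proof -
      have "summable (\<lambda>k. g k n)" using cols[of n] has_sum_imp_sums sums_summable by blast
      from suminf_of_real[OF this, where ?'a = complex] show ?thesis by (simp add: g_def)
    qed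
    ultimately have "(\<lambda>n. complex_of_real (\<Sum>k. g k n)) sums of_real ((1 - rr_x q) / 5)"
      by simp
    thus ?thesis by (simp only: sums_of_real_iff)
  qed
  ultimately show ?thesis using 1 by (metis sums_unique2)
qed

section \<open>Termwise differentiation of log R\<close>

lemma abs_ln_one_minus_le:
  fixes y c :: real
  assumes "0 \<le> y" "y \<le> c" "c < 1"
  shows "\<bar>ln (1 - y)\<bar> \<le> y / (1 - c)"
proof -
  have "ln (1 / (1 - y)) \<le> 1 / (1 - y) - 1"
    using assms by (intro ln_le_minus_one) auto
  also have "\<dots> = y / (1 - y)" using assms by (simp add: field_simps)
  also have "\<dots> \<le> y / (1 - c)" using assms by (intro divide_left_mono mult_pos_pos) auto
  finally show ?thesis using assms by (simp add: ln_div)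
qed

lemma summable_chi5_ln:
  fixes q :: real
  assumes q: "0 < q" "q < 1"
  shows "summable (\<lambda>k. chi5 k * ln (1 - q ^ k))"
proof (rule summable_comparison_test')
  show "summable (\<lambda>k. 1 / (1 - q) * q ^ k)"
    using q by (intro summable_mult summable_geometric) auto
  fix k :: nat
  show "norm (chi5 k * ln (1 - q ^ k)) \<le> 1 / (1 - q) * q ^ k"
  proof (cases "k = 0")
    case False
    have "q ^ k \<le> q" using q False power_decreasing[of 1 k q] by simp
    hence "\<bar>ln (1 - q ^ k)\<bar> \<le> q ^ k / (1 - q)"
      using q by (intro abs_ln_one_minus_le) auto
    hence "\<bar>chi5 k\<bar> * \<bar>ln (1 - q ^ k)\<bar> \<le> 1 * (q ^ k / (1 - q))"
      by (intro mult_mono abs_chi5_le_1) auto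
    thus ?thesis by (simp add: abs_mult)
  qed (use q in auto)
qed

text \<open>The logarithm of R without its power of q, spread over all \<open>k\<close> by the
  character. At \<open>k = 0\<close>, where the logarithm would be taken at 0, the character
  vanishes.\<close>

definition rr_log :: "real \<Rightarrow> real" where
  "rr_log q = (\<Sum>k. chi5 k * ln (1 - q ^ k))"

lemma rogers_ramanujan_cf_eq_exp:
  assumes q: "0 < q" "q < 1"
  shows "rogers_ramanujan_cf q = q powr (1 / 5) * exp (rr_log q)"
proof -
  have pos: "1 - q ^ k > 0" if "k > 0" for k
    using q that by (simp add: power_less_one_iff)
  have "(\<lambda>n. \<Sum>k = n * 5..<n * 5 + 5. chi5 k * ln (1 - q ^ k)) sums rr_log q"
    unfolding rr_log_def using summable_chi5_ln[OF q] by (intro sums_group summable_sums) auto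
  moreover have "(\<Sum>k = n * 5..<n * 5 + 5. chi5 k * ln (1 - q ^ k)) =
     ln (((1 - q ^ (5 * n + 1)) * (1 - q ^ (5 * n + 4))) / ((1 - q ^ (5 * n + 2)) * (1 - q ^ (5 * n + 3))))" for n
  proof -
    have "{n * 5..<n * 5 + 5} = {5 * n, 5 * n + 1, 5 * n + 2, 5 * n + 3, 5 * n + 4}" by auto
    moreover have "chi5 (5 * n) = 0" "chi5 (5 * n + 1) = 1" "chi5 (5 * n + 2) = -1" "chi5 (5 * n + 3) = -1"
      "chi5 (5 * n + 4) = 1"
      by (simp_all add: chi5_def mod_Suc)
    ultimately have "(\<Sum>k = n * 5..<n * 5 + 5. chi5 k * ln (1 - q ^ k))
       = ln (1 - q ^ (5 * n + 1)) - ln (1 - q ^ (5 * n + 2)) - ln (1 - q ^ (5 * n + 3)) + ln (1 - q ^ (5 * n + 4))"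
      by simp
    moreover have "1 - q ^ (5 * n + 1) > 0" "1 - q ^ (5 * n + 2) > 0" "1 - q ^ (5 * n + 3) > 0" "1 - q ^ (5 * n + 4) > 0"
      by (rule pos; simp)+
    ultimately show ?thesis by (simp add: ln_div ln_mult del: power_Suc)
  qed
  ultimately have "(\<lambda>n. ln (((1 - q ^ (5 * n + 1)) * (1 - q ^ (5 * n + 4))) / ((1 - q ^ (5 * n + 2)) * (1 - q ^ (5 * n + 3))))) sums rr_log q"
    by simp
  hence "(\<lambda>n. exp (ln (((1 - q ^ (5 * n + 1)) * (1 - q ^ (5 * n + 4))) / ((1 - q ^ (5 * n + 2)) * (1 - q ^ (5 * n + 3)))))) has_prod exp (rr_log q)"
    unfolding has_prod_def by (intro disjI1 sums_imp_has_prod_exp)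
  moreover have "exp (ln (((1 - q ^ (5 * n + 1)) * (1 - q ^ (5 * n + 4))) / ((1 - q ^ (5 * n + 2)) * (1 - q ^ (5 * n + 3)))))
     = ((1 - q ^ (5 * n + 1)) * (1 - q ^ (5 * n + 4))) / ((1 - q ^ (5 * n + 2)) * (1 - q ^ (5 * n + 3)))" for n
    by (intro exp_ln divide_pos_pos mult_pos_pos pos) auto
  ultimately show ?thesis
    unfolding rogers_ramanujan_cf_def by (simp add: has_prod_iff)
qed

text \<open>On \<open>{0<..<r}\<close> with \<open>q < r < 1\<close> the differentiated series is
  dominated by a multiple of the sum of k r^k, so it may be differentiated term by term.\<close>

lemma has_real_derivative_rr_log:
  assumes q: "0 < q" "q < 1"
  shows "(rr_log has_real_derivative ((rr_x q - 1) / (5 * q))) (at q)"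
proof -
  define r where "r = (1 + q) / 2"
  have r: "q < r" "r < 1" "0 < r" using q by (auto simp: r_def)
  define f' where "f' = (\<lambda>k x. chi5 k * - (real k * x ^ (k - 1) / (1 - x ^ k)))"
  have "((\<lambda>x. \<Sum>k. chi5 k * ln (1 - x ^ k)) has_field_derivative (\<Sum>k. f' k q)) (at q)"
  proof (rule has_field_derivative_series'(2)[where S = "{0<..<r}" and ?x0.0 = q])
    fix k x assume x: "x \<in> {0<..<r}"
    show "((\<lambda>x. chi5 k * ln (1 - x ^ k)) has_field_derivative f' k x) (at x within {0<..<r})"
    proof (cases "k = 0")
      case False
      hence "1 - x ^ k > 0" using x r by (simp add: power_less_one_iff)
      thus ?thesis unfolding f'_def
        by (auto intro!: derivative_eq_intros)
    qed (simp add: f'_def)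
  next
    show "uniformly_convergent_on {0<..<r} (\<lambda>n x. \<Sum>i<n. f' i x)"
    proof (rule Weierstrass_m_test')
      have "summable (\<lambda>k. real k * r ^ k)"
        using sums_of_nat_power[of r] r by (auto simp: sums_iff)
      thus "summable (\<lambda>k. 1 / (r * (1 - r)) * (real k * r ^ k))"
        by (rule summable_mult)
      fix k x assume x: "x \<in> {0<..<r}"
      show "norm (f' k x) \<le> 1 / (r * (1 - r)) * (real k * r ^ k)"
      proof (cases "k = 0")
        case False
        have xk: "x ^ k \<le> r"
          using x r False power_decreasing[of 1 k x] by auto
        have "x ^ (k - 1) \<le> r ^ (k - 1)" using x by (intro power_mono) auto
        hence "x ^ (k - 1) / (1 - x ^ k) \<le> r ^ (k - 1) / (1 - r)"
          using x xk r by (intro frac_le) auto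
        moreover have "x ^ (k - 1) / (1 - x ^ k) \<ge> 0" using x xk r by (intro divide_nonneg_nonneg) auto
        ultimately have "\<bar>chi5 k\<bar> * (real k * (x ^ (k - 1) / (1 - x ^ k))) \<le> 1 * (real k * (r ^ (k - 1) / (1 - r)))"
          using mult_nonneg_nonneg[of "real k" "x ^ (k - 1) / (1 - x ^ k)"]
          by (intro mult_mono abs_chi5_le_1 mult_left_mono) auto
        also have "r ^ (k - 1) = r ^ k / r" using r False by (simp add: power_diff)
        finally show ?thesis using \<open>x ^ (k - 1) / (1 - x ^ k) \<ge> 0\<close> xk r x
          by (simp add: f'_def abs_mult mult_ac)
      qed (simp add: f'_def)
    qed
  qed (use q r in \<open>auto intro: summable_chi5_ln simp: interior_open\<close>)
  also have "(\<Sum>k. f' k q) = (rr_x q - 1) / (5 * q)"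
  proof -
    have "(\<lambda>k. - (1 / q) * (of_nat k * chi5 k * (q ^ k / (1 - q ^ k)))) sums (- (1 / q) * ((1 - rr_x q) / 5))"
      by (intro sums_mult lambert_chi5 q)
    moreover have "- (1 / q) * (of_nat k * chi5 k * (q ^ k / (1 - q ^ k))) = f' k q" for k
      using q by (cases k) (simp_all add: f'_def)
    moreover have "- (1 / q) * ((1 - rr_x q) / 5) = (rr_x q - 1) / (5 * q)"
      using q by (simp add: field_simps)
    ultimately show ?thesis by (simp add: sums_iff)
  qed
  finally show ?thesis by (simp add: rr_log_def[abs_def])
qed

text \<open>The logarithmic derivative 1 / (5q) of q^(1/5) cancels the constant -1 left by the
  Lambert series, so a pure eta quotient remains.\<close>

theorem has_real_derivative_rogers_ramanujan_cf:
  assumes q: "0 < q" "q < 1"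
  shows "(rogers_ramanujan_cf has_real_derivative (rogers_ramanujan_cf q * rr_x q / (5 * q))) (at q)"
proof -
  have "((\<lambda>q. q powr (1 / 5) * exp (rr_log q)) has_real_derivative
     (q powr (1 / 5) * exp (rr_log q) * rr_x q / (5 * q))) (at q)"
  proof -
    have "q powr (1 / 5 - 1) = q powr (1 / 5) / q"
      using q by (subst powr_diff) simp
    thus ?thesis
      using DERIV_mult[OF has_real_derivative_powr[OF q(1), of "1 / 5"] DERIV_fun_exp[OF has_real_derivative_rr_log[OF q]]] q
      by (simp only:) (simp add: field_simps)
  qed
  moreover have "\<forall>\<^sub>F x in nhds q. rogers_ramanujan_cf x = x powr (1 / 5) * exp (rr_log x)"
    using eventually_nhds_in_open[of "{0<..<1}" q] q
    by (auto elim!: eventually_mono simp: rogers_ramanujan_cf_eq_exp)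
  ultimately show ?thesis
    using q by (subst DERIV_cong_ev[OF refl _ refl]) (auto simp: rogers_ramanujan_cf_eq_exp)
qed

section \<open>Positivity, monotonicity and limits at 0 of the real products\<close>

lemma qpoch_real_mono:
  fixes z z' p p' :: real
  assumes "0 \<le> z" "z \<le> z'" "z' \<le> 1" "0 \<le> p" "p \<le> p'" "p' < 1"
  shows "qpoch z' p' \<le> qpoch z p"
proof (rule has_prod_le[OF has_prod_qpoch has_prod_qpoch])
  fix n
  have "z * p ^ n \<le> z' * p' ^ n" using assms by (intro mult_mono power_mono) auto
  moreover have "z' * p' ^ n \<le> 1 * 1" using assms by (intro mult_mono power_le_one) auto
  ultimately show "0 \<le> 1 - z' * p' ^ n \<and> 1 - z' * p' ^ n \<le> 1 - z * p ^ n" by simp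
qed (use assms in auto)

lemma qpoch_real_pos:
  fixes z p :: real
  assumes "0 \<le> z" "z < 1" "0 \<le> p" "p < 1"
  shows "0 < qpoch z p"
proof -
  have "z * p ^ n < 1" for n
    using assms mult_mono[of z z "p ^ n" 1] power_le_one[of p n] by simp
  hence *: "1 - z * p ^ n > 0" for n by (simp add: algebra_simps)
  thus ?thesis
    using has_prod_pos[OF has_prod_qpoch[of p z]] assms by simp
qed

lemma qpoch_real_bounds:
  fixes z p :: real
  assumes "0 \<le> z" "z \<le> 1" "0 \<le> p" "p < 1"
  shows "1 - z / (1 - p) \<le> qpoch z p" "qpoch z p \<le> 1"
proof -
  have zp: "z * p ^ n \<in> {0..1}" for n
    using assms mult_mono[of z 1 "p ^ n" 1] power_le_one[of p n] by simp
  have "1 - (\<Sum>n<N. z * p ^ n) \<le> (\<Prod>n<N. 1 - z * p ^ n)" for N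
    by (rule Weierstrass_prod_ineq) (use zp in auto)
  moreover have "(\<lambda>N. 1 - (\<Sum>n<N. z * p ^ n)) \<longlonglongrightarrow> 1 - z * (1 / (1 - p))"
    using geometric_sums[of p] sums_mult[of "\<lambda>n. p ^ n" "1 / (1 - p)" z] assms
    by (intro tendsto_intros) (auto simp: sums_def)
  ultimately show "1 - z / (1 - p) \<le> qpoch z p"
    using qpoch_LIMSEQ[of p z] assms by (auto intro!: LIMSEQ_le)
  show "qpoch z p \<le> 1"
    by (rule LIMSEQ_le_const2[OF qpoch_LIMSEQ]) (use assms zp in \<open>auto intro!: prod_le_1\<close>)
qed

lemma tendsto_qpoch_at_right_0:
  assumes "i > 0" "j > 0"
  shows "((\<lambda>x::real. qpoch (x ^ i) (x ^ j)) \<longlongrightarrow> 1) (at_right 0)"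
proof (rule tendsto_sandwich)
  have ev: "\<forall>\<^sub>F x::real in at_right 0. x \<in> {0<..<1}"
    by (rule eventually_at_right_real) auto
  show "\<forall>\<^sub>F x::real in at_right 0. 1 - x ^ i / (1 - x ^ j) \<le> qpoch (x ^ i) (x ^ j)"
    using ev by eventually_elim (use assms in \<open>auto intro!: qpoch_real_bounds power_le_one simp: power_less_one_iff\<close>)
  show "\<forall>\<^sub>F x::real in at_right 0. qpoch (x ^ i) (x ^ j) \<le> 1"
    using ev by eventually_elim (use assms in \<open>auto intro!: qpoch_real_bounds power_le_one simp: power_less_one_iff\<close>)
  have "((\<lambda>x::real. 1 - x ^ i / (1 - x ^ j)) \<longlongrightarrow> 1 - 0 ^ i / (1 - 0 ^ j)) (at_right 0)"
    using assms by (intro tendsto_intros) (auto simp: power_0_left)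
  moreover have "1 - 0 ^ i / (1 - 0 ^ j) = (1 :: real)"
    using assms by (simp add: power_0_left)
  ultimately show "((\<lambda>x::real. 1 - x ^ i / (1 - x ^ j)) \<longlongrightarrow> 1) (at_right 0)"
    by simp
qed auto

lemma rr_theta_eq:
  assumes "q \<noteq> 0"
  shows "th1 q = qpoch q (q ^ 5) * qpoch (q ^ 4) (q ^ 5)"
    and "th2 q = qpoch (q\<^sup>2) (q ^ 5) * qpoch (q ^ 3) (q ^ 5)"
proof -
  have "q ^ 5 / q = q ^ 4" "q ^ 5 / q\<^sup>2 = q ^ 3" using assms by (simp_all add: eval_nat_numeral)
  thus "th1 q = qpoch q (q ^ 5) * qpoch (q ^ 4) (q ^ 5)"
    and "th2 q = qpoch (q\<^sup>2) (q ^ 5) * qpoch (q ^ 3) (q ^ 5)"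
    by (simp_all add: th1_def th2_def jtheta_def)
qed

lemma rr_theta_pos:
  assumes "0 < q" "q < 1"
  shows "0 < th1 q" "0 < th2 q" "0 < euler_f q"
  using assms by (auto simp: rr_theta_eq euler_f_def power_less_one_iff intro!: mult_pos_pos qpoch_real_pos)

text \<open>Replacing \<open>q\<close> by the smaller \<open>q ^ 3\<close> enlarges every factor of
  the products. This later orders P and Q.\<close>

lemma rr_theta_mono:
  assumes "0 < q" "q < 1"
  shows "th1 q * th2 q \<le> th1 (q ^ 3) * th2 (q ^ 3)"
proof -
  have pw: "(q ^ 3) ^ k \<le> q ^ k" for k
    using assms by (intro power_mono) (auto intro: power_le_one_iff[THEN iffD2] simp: power_le_one power3_eq_cube mult_le_one)
  have k: "q ^ k < 1" if "k > 0" for k using assms that by (simp add: power_less_one_iff)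
  have "qpoch (q ^ k) (q ^ 5) \<le> qpoch ((q ^ 3) ^ k) ((q ^ 3) ^ 5)" if "k > 0" for k
    by (rule qpoch_real_mono) (use assms pw k that in \<open>auto intro: less_imp_le\<close>)
  from this[of 1] this[of 2] this[of 3] this[of 4]
  show ?thesis
    using assms by (auto simp: rr_theta_eq power_less_one_iff intro!: mult_mono mult_nonneg_nonneg less_imp_le[OF qpoch_real_pos])
qed

section \<open>The cubic equation of R, its factors and its derivative\<close>

lemma rogers_ramanujan_cf_eq_theta:
  assumes "0 < q" "q < 1"
  shows "rogers_ramanujan_cf q = q powr (1 / 5) * (th1 q / th2 q)"
proof -
  have q5: "norm (q ^ 5) < 1" using assms by (simp add: power_less_one_iff)
  have th: "0 < th2 q" using rr_theta_pos assms by simp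
  hence nz: "qpoch (q\<^sup>2) (q ^ 5) \<noteq> 0" "qpoch (q ^ 3) (q ^ 5) \<noteq> 0" using assms by (auto simp: rr_theta_eq)
  have "(\<lambda>n. ((1 - q * (q ^ 5) ^ n) * (1 - q ^ 4 * (q ^ 5) ^ n)) / ((1 - q\<^sup>2 * (q ^ 5) ^ n) * (1 - q ^ 3 * (q ^ 5) ^ n)))
     has_prod (th1 q / th2 q)"
    using assms unfolding rr_theta_eq[OF less_imp_neq[OF assms(1), symmetric]]
    by (intro has_prod_divide has_prod_mult has_prod_qpoch q5)
  moreover have "((1 - q * (q ^ 5) ^ n) * (1 - q ^ 4 * (q ^ 5) ^ n)) / ((1 - q\<^sup>2 * (q ^ 5) ^ n) * (1 - q ^ 3 * (q ^ 5) ^ n))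
    = ((1 - q ^ (5 * n + 1)) * (1 - q ^ (5 * n + 4))) / ((1 - q ^ (5 * n + 2)) * (1 - q ^ (5 * n + 3)))" for n
    by (simp add: power_add mult.commute power2_eq_square flip: power_mult)
  ultimately show ?thesis
    unfolding rogers_ramanujan_cf_def by (simp add: has_prod_iff)
qed

lemma rogers_ramanujan_cf_pos:
  assumes "0 < q" "q < 1"
  shows "0 < rogers_ramanujan_cf q"
  using assms rr_theta_pos[OF assms] by (simp add: rogers_ramanujan_cf_eq_theta)

definition rr_y :: "real \<Rightarrow> real" where
  "rr_y q = q * euler_f (q ^ 5) ^ 5 / euler_f q"

lemma rr_xy_pos:
  assumes "0 < q" "q < 1"
  shows "0 < rr_x q" "0 < rr_y q"
  using assms by (auto simp: rr_x_def rr_y_def power_less_one_iff intro!: divide_pos_pos mult_pos_pos zero_less_power rr_theta_pos)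

text \<open>With \<open>t\<close> = q^(1/5) all fractional powers become integral. \<open>F1\<close>
  carries \<open>e\<^sup>2\<close> and \<open>F2\<close> its inverse: the product is free of
  \<open>e\<close>, while the quotient keeps \<open>e ^ 4\<close>, which is what the ratio of the
  two values of \<open>rr_y\<close> contains.\<close>

lemma rr_cubic_factors:
  assumes q: "0 < q" "q < 1"
  defines "u \<equiv> rogers_ramanujan_cf q" and "v \<equiv> rogers_ramanujan_cf (q ^ 3)"
  shows "(v - u ^ 3) * (1 + u * v ^ 3) = 3 * u\<^sup>2 * v\<^sup>2"
    and "(v - u ^ 3) * v * rr_y q = 3 * (1 + u * v ^ 3) * u * rr_y (q ^ 3)"
    and "u ^ 3 < v"
proof -
  have q3: "0 < q ^ 3" "q ^ 3 < 1" using q by (simp_all add: power_less_one_iff)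
  define t where "t = q powr (1 / 5)"
  have t: "t > 0" using q by (simp add: t_def)
  have t5: "q = t ^ 5" using q by (simp add: t_def powr_power)
  have t3: "(q ^ 3) powr (1 / 5) = t ^ 3" using q by (simp add: t_def powr_power powr_powr flip: powr_numeral)
  define a b c d where "a = th1 q" and "b = th2 q" and "c = th1 (q ^ 3)" and "d = th2 (q ^ 3)"
  define e where "e = euler_f (q ^ 15) / euler_f (q ^ 5)"
  have pos: "a > 0" "b > 0" "c > 0" "d > 0" "e > 0"
    using q q3 rr_theta_pos(3)[of "q ^ 15"] rr_theta_pos(3)[of "q ^ 5"]
    by (auto simp: a_def b_def c_def d_def e_def power_less_one_iff intro!: rr_theta_pos)
  have u: "u = t * (a / b)" using q by (simp add: u_def rogers_ramanujan_cf_eq_theta t_def a_def b_def)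
  have v: "v = t ^ 3 * (c / d)" using q3 by (simp add: v_def rogers_ramanujan_cf_eq_theta t3 c_def d_def)
  have I1: "b ^ 3 * c - a ^ 3 * d = 3 * t ^ 5 * (a * b)\<^sup>2 * e\<^sup>2"
    using rr_theta_identity1[OF q] by (simp add: a_def b_def c_def d_def e_def t5)
  have I2: "b * d ^ 3 + t ^ 10 * a * c ^ 3 = (c * d)\<^sup>2 / e\<^sup>2"
    using rr_theta_identity2[OF q] by (simp add: a_def b_def c_def d_def e_def t5 power_divide flip: power_mult)
  have F1: "v - u ^ 3 = 3 * t ^ 8 * a\<^sup>2 / (b * d) * e\<^sup>2"
  proof -
    have "v - u ^ 3 = t ^ 3 * ((b ^ 3 * c - a ^ 3 * d) / (d * b ^ 3))"
      using pos by (simp add: u v field_simps)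
    also have "\<dots> = 3 * t ^ 8 * a\<^sup>2 / (b * d) * e\<^sup>2"
      unfolding I1 using pos by (simp add: field_simps eval_nat_numeral)
    finally show ?thesis .
  qed
  have F2: "1 + u * v ^ 3 = c\<^sup>2 / (b * d) / e\<^sup>2"
  proof -
    have "1 + u * v ^ 3 = (b * d ^ 3 + t ^ 10 * a * c ^ 3) / (b * d ^ 3)"
      using pos by (simp add: u v field_simps flip: power_mult power_Suc power_Suc2 power_add)
    also have "\<dots> = c\<^sup>2 / (b * d) / e\<^sup>2"
      unfolding I2 using pos by (simp add: field_simps eval_nat_numeral)
    finally show ?thesis .
  qed
  show "(v - u ^ 3) * (1 + u * v ^ 3) = 3 * u\<^sup>2 * v\<^sup>2"
    unfolding F1 F2 using pos by (simp add: u v field_simps eval_nat_numeral)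
  show "u ^ 3 < v"
  proof -
    have "0 < v - u ^ 3" unfolding F1 using pos t by simp
    thus ?thesis by simp
  qed
  have E: "a * b = euler_f q / euler_f (q ^ 5)" "c * d = euler_f (q ^ 3) / euler_f (q ^ 15)"
    using rr_theta_mult[OF q] rr_theta_mult[OF q3] by (simp_all add: a_def b_def c_def d_def flip: power_mult)
  have Epos: "euler_f q > 0" "euler_f (q ^ 3) > 0" "euler_f (q ^ 5) > 0" "euler_f (q ^ 15) > 0"
    using q by (auto intro!: rr_theta_pos simp: power_less_one_iff)
  have "rr_y (q ^ 3) / rr_y q = q\<^sup>2 * (a * b) / (c * d) * e ^ 4"
    unfolding E e_def rr_y_def using q Epos by (simp add: field_simps eval_nat_numeral flip: power_mult)
  hence y: "rr_y (q ^ 3) = t ^ 10 * (a * b) / (c * d) * e ^ 4 * rr_y q"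
    using rr_xy_pos[OF q] by (simp add: t5 field_simps flip: power_mult)
  show "(v - u ^ 3) * v * rr_y q = 3 * (1 + u * v ^ 3) * u * rr_y (q ^ 3)"
    unfolding F1 F2 y using pos by (simp add: u v field_simps eval_nat_numeral)
qed

text \<open>The derivative of the cubic equation along \<open>q\<close>. The factor 3 before
  \<open>rr_x (q ^ 3)\<close> is the chain rule for q^3, after the common 1 / (5q) is
  removed.\<close>

lemma rr_derivative_relation:
  assumes q: "0 < q" "q < 1"
  defines "u \<equiv> rogers_ramanujan_cf q" and "v \<equiv> rogers_ramanujan_cf (q ^ 3)"
  shows "rr_x q * (- 3 * u ^ 3 * (1 + u * v ^ 3) + (v - u ^ 3) * u * v ^ 3 - 6 * u\<^sup>2 * v\<^sup>2)
     + 3 * rr_x (q ^ 3) * (v * (1 + u * v ^ 3) + 3 * (v - u ^ 3) * u * v ^ 3 - 6 * u\<^sup>2 * v\<^sup>2) = 0"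
proof -
  have q3: "0 < q ^ 3" "q ^ 3 < 1" using q by (simp_all add: power_less_one_iff)
  define R where "R = rogers_ramanujan_cf"
  define G where "G = (\<lambda>x. (R (x ^ 3) - R x ^ 3) * (1 + R x * R (x ^ 3) ^ 3) - 3 * (R x)\<^sup>2 * (R (x ^ 3))\<^sup>2)"
  define u' v' where "u' = u * rr_x q / (5 * q)" and "v' = v * rr_x (q ^ 3) / (5 * q ^ 3) * (3 * q\<^sup>2)"
  have du: "(R has_real_derivative u') (at q)"
    unfolding R_def u'_def u_def by (rule has_real_derivative_rogers_ramanujan_cf[OF q])
  have dv: "((\<lambda>x. R (x ^ 3)) has_real_derivative v') (at q)"
    unfolding R_def v'_def v_def
    by (rule DERIV_chain2[where f = rogers_ramanujan_cf and g = "\<lambda>x. x ^ 3", OF has_real_derivative_rogers_ramanujan_cf[OF q3]])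
       (auto intro!: derivative_eq_intros)
  have Ruv: "R q = u" "R (q ^ 3) = v" by (simp_all add: R_def u_def v_def)
  have "(G has_real_derivative ((v' - 3 * u\<^sup>2 * u') * (1 + u * v ^ 3)
     + (v - u ^ 3) * (u' * v ^ 3 + u * (3 * v\<^sup>2 * v')) - 3 * (2 * u * u' * v\<^sup>2 + u\<^sup>2 * (2 * v * v')))) (at q)"
    unfolding G_def by (auto intro!: derivative_eq_intros du dv simp: Ruv algebra_simps)
  moreover have "(G has_real_derivative 0) (at q)"
  proof (rule DERIV_cong_ev[THEN iffD1, OF refl _ refl DERIV_const])
    show "\<forall>\<^sub>F x in nhds q. 0 = G x"
      using eventually_nhds_in_open[of "{0<..<1}" q] q rr_cubic_factors(1)
      by (auto elim!: eventually_mono simp: G_def R_def)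
  qed
  ultimately have "(v' - 3 * u\<^sup>2 * u') * (1 + u * v ^ 3)
     + (v - u ^ 3) * (u' * v ^ 3 + u * (3 * v\<^sup>2 * v')) - 3 * (2 * u * u' * v\<^sup>2 + u\<^sup>2 * (2 * v * v')) = 0"
    by (rule DERIV_unique)
  moreover have "u' = u * (rr_x q / (5 * q))" "v' = v * (3 * rr_x (q ^ 3) / (5 * q))"
    using q by (simp_all add: u'_def v'_def eval_nat_numeral)
  ultimately have "(rr_x q * (- 3 * u ^ 3 * (1 + u * v ^ 3) + (v - u ^ 3) * u * v ^ 3 - 6 * u\<^sup>2 * v\<^sup>2)
     + 3 * rr_x (q ^ 3) * (v * (1 + u * v ^ 3) + 3 * (v - u ^ 3) * u * v ^ 3 - 6 * u\<^sup>2 * v\<^sup>2)) / (5 * q) = 0"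
    using q by (simp add: divide_simps) (simp add: algebra_simps power2_eq_square power3_eq_cube)
  thus ?thesis using q by simp
qed

section \<open>The modular curve of degree 3\<close>

text \<open>
  With \<open>u = R(q)\<close>, \<open>v = R(q ^ 3)\<close>, \<open>m = v / u ^ 3\<close> and \<open>l = (m - 1) / (m\<^sup>2 u ^ 5)\<close>, the cubic modular equation
  of \<open>R\<close> becomes the elliptic curve \<open>l (3 - l) m = (m - 1)\<^sup>2\<close>. In the notation of the fourth identity,
  \<open>H / X\<close> is a rational function on it whose square is \<open>p3 / p1\<close>, where \<open>p1 = 1 / u ^ 5 - 11 - u ^ 5\<close> and
  \<open>p3 = 1 / v ^ 5 - 11 - v ^ 5\<close>; and \<open>p1 H / X = Y / (m (m - 1)\<^sup>2)\<close>.
\<close>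

lemma curve_id1:
  fixes m l :: real
  assumes "l * (3 - l) * m = (m - 1)\<^sup>2"
  shows "(2 * m - 1 - l * (m - 1)) * (m * l ^ 3 - m\<^sup>2 * (3 - l) ^ 3 - 11 * (m - 1) ^ 3)
    = (9 + 3 * (m - 1) + l * (m - 1)) * (l * m ^ 3 - (3 - l) - 11 * m * (m - 1))"
  using assms by algebra

text \<open>The derivative relation leads to p3 / p1 = m N / ((m - 1)^2 D), where D is the last
  factor on the left and N the second on the right. This identity exhibits that quotient as a square
  on the curve.\<close>

lemma curve_id2:
  fixes m l :: real
  assumes "l * (3 - l) * m = (m - 1)\<^sup>2"
  shows "(m\<^sup>2 + 7 * m + 1)\<^sup>2 * (2 * m - 1 - l * (m - 1))
    = m * (9 + 3 * (m - 1) + l * (m - 1)) * (l * (m + 1) + 1 - 4 * m)\<^sup>2"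
  using assms by algebra

lemma curve_id3:
  fixes m l :: real
  assumes "l * (3 - l) * m = (m - 1)\<^sup>2"
  shows "(l * m ^ 3 - (3 - l) - 11 * m * (m - 1)) * (m\<^sup>2 + 7 * m + 1)
    = (m ^ 4 + 2 * m ^ 3 + 15 * m\<^sup>2 - 10 * m + 1 - 4 * l * m * (m\<^sup>2 - 1)) * (l * (m + 1) + 1 - 4 * m)"
  using assms by algebra

text \<open>The cleared form of (t - 1/t - 9)(t + 1/t) = z + 125/z for t = H / X and z = Y / (m (m -
  1)^2).\<close>

lemma curve_id4:
  fixes m l :: real
  assumes "l * (3 - l) * m = (m - 1)\<^sup>2"
  defines "H \<equiv> m\<^sup>2 + 7 * m + 1" and "X \<equiv> (m - 1) * (l * (m + 1) + 1 - 4 * m)"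
    and "Y \<equiv> m ^ 4 + 2 * m ^ 3 + 15 * m\<^sup>2 - 10 * m + 1 - 4 * l * m * (m\<^sup>2 - 1)"
  shows "(H\<^sup>2 - 9 * H * X - X\<^sup>2) * (H\<^sup>2 + X\<^sup>2) * Y * m * (m - 1)\<^sup>2
    = H\<^sup>2 * X\<^sup>2 * (Y\<^sup>2 + 125 * m\<^sup>2 * (m - 1) ^ 4)"
  unfolding H_def X_def Y_def using assms(1) by algebra

lemma clear_curve_denoms:
  fixes m c l :: real
  assumes "m \<noteq> 0" "c \<noteq> 0"
  shows "m * c * (l * m\<^sup>2 / c - 11 - (3 - l) / (m * c)) = l * m ^ 3 - (3 - l) - 11 * m * c"
  using assms by (simp add: field_simps power2_eq_square power3_eq_cube)

text \<open>All relations are homogeneous enough for powers of \<open>u\<close> to factor out,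
  leaving \<open>m\<close> and \<open>U = u ^ 5\<close>. The cubic equation reads c (1 + m^3 U^2) =
  3 m^2 U with c = m - 1; divided by m^2 U it splits 3 into c / (m^2 U) and c m U. These are
  \<open>l\<close> and \<open>3 - l\<close>, and their product c^2 / m gives the curve.\<close>

lemma curve_parameters:
  fixes u v y1 y3 a b :: real
  assumes pos: "u > 0" "u ^ 3 < v"
    and curve: "(v - u ^ 3) * (1 + u * v ^ 3) = 3 * u\<^sup>2 * v\<^sup>2"
    and ratio: "(v - u ^ 3) * v * y1 = 3 * (1 + u * v ^ 3) * u * y3"
    and deriv: "a * (- 3 * u ^ 3 * (1 + u * v ^ 3) + (v - u ^ 3) * u * v ^ 3 - 6 * u\<^sup>2 * v\<^sup>2)
     + 3 * b * (v * (1 + u * v ^ 3) + 3 * (v - u ^ 3) * u * v ^ 3 - 6 * u\<^sup>2 * v\<^sup>2) = 0"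
  obtains m l where "m > 1" "l > 0" "l * (3 - l) * m = (m - 1)\<^sup>2"
    "u ^ 5 = (3 - l) / (m * (m - 1))" "1 / u ^ 5 = l * m\<^sup>2 / (m - 1)"
    "v ^ 5 = m\<^sup>2 * (3 - l) ^ 3 / (m - 1) ^ 3" "1 / v ^ 5 = m * l ^ 3 / (m - 1) ^ 3"
    "9 * m * y3 = (m - 1)\<^sup>2 * y1"
    "9 * b * (2 * m - 1 - l * (m - 1)) = a * (9 + 3 * (m - 1) + l * (m - 1))"
proof -
  define m U c where "m = v / u ^ 3" and "U = u ^ 5" and "c = v / u ^ 3 - 1"
  define l where "l = c / (U * m\<^sup>2)"
  define w where "w = 1 + m ^ 3 * U\<^sup>2"
  have U: "U > 0" using pos by (simp add: U_def)
  have v: "v = m * u ^ 3" using pos by (simp add: m_def)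
  have m: "m > 1" using pos by (simp add: m_def)
  have c: "c > 0" "c = m - 1" using m by (simp_all add: c_def m_def)
  have l: "l > 0" using U c m by (simp add: l_def)
  have uv: "v - u ^ 3 = u ^ 3 * c" "1 + u * v ^ 3 = w" "u * v ^ 3 = m ^ 3 * U\<^sup>2" "u\<^sup>2 * v\<^sup>2 = u ^ 3 * (m\<^sup>2 * U)"
    by (simp_all add: v c w_def U_def algebra_simps power_mult_distrib flip: power_mult power_add power_Suc)
  have "u ^ 3 * (c * w) = u ^ 3 * (3 * m\<^sup>2 * U)"
    using curve uv(4) unfolding uv(1,2) by (simp add: mult_ac)
  hence cw: "c * w = 3 * m\<^sup>2 * U" using pos by simp
  have lU: "c = l * m\<^sup>2 * U" using U m by (simp add: l_def)
  have l3: "3 - l = c * m * U"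
  proof -
    have "(3 - l) * (m\<^sup>2 * U) = (c * m * U) * (m\<^sup>2 * U)"
      using cw lU by (simp add: w_def algebra_simps power2_eq_square power3_eq_cube)
    thus ?thesis using U m by simp
  qed
  have rel: "l * (3 - l) * m = c\<^sup>2"
    unfolding l3 using lU by (simp add: power2_eq_square mult_ac)
  have 1: "U = (3 - l) / (m * c)" unfolding l3 using m c by simp
  have 2: "1 / U = l * m\<^sup>2 / c" using lU U c by (simp add: field_simps)
  have V: "v ^ 5 = m ^ 5 * U ^ 3" by (simp add: v U_def power_mult_distrib flip: power_mult)
  have 3: "v ^ 5 = m\<^sup>2 * (3 - l) ^ 3 / c ^ 3"
    unfolding V l3 using c by (simp add: power_mult_distrib flip: power_add)
  have 4: "1 / v ^ 5 = m * l ^ 3 / c ^ 3"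
  proof -
    have "1 / v ^ 5 = (1 / U) ^ 3 / m ^ 5" unfolding V using m by (simp add: power_divide)
    also have "\<dots> = m * l ^ 3 / c ^ 3"
      unfolding 2 using m by (simp add: power_divide power_mult_distrib eval_nat_numeral)
    finally show ?thesis .
  qed
  have 5: "9 * m * y3 = c\<^sup>2 * y1"
  proof -
    have "u * (U * c * m * y1) = u * (3 * w * y3)"
      using ratio unfolding uv(1,2) by (simp add: v U_def eval_nat_numeral mult_ac)
    hence "U * c * m * y1 = 3 * w * y3" using pos by simp
    hence "U * c * m * y1 * c = 3 * (c * w) * y3" by simp
    hence "(m * U) * (c\<^sup>2 * y1) = (m * U) * (9 * m * y3)"
      unfolding cw by (simp add: power2_eq_square mult_ac)
    thus ?thesis using m U by simp
  qed
  have 6: "9 * b * (2 * m - 1 - l * c) = a * (9 + 3 * c + l * c)"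
  proof -
    have "a * (- 3 * (u ^ 3 * (1 + u * v ^ 3)) + (v - u ^ 3) * (u * v ^ 3) - 6 * (u\<^sup>2 * v\<^sup>2))
        + 3 * b * (v * (1 + u * v ^ 3) + 3 * ((v - u ^ 3) * (u * v ^ 3)) - 6 * (u\<^sup>2 * v\<^sup>2)) = 0"
      using deriv by (simp only: mult.assoc)
    from this[unfolded uv(2), unfolded uv(1,3,4), unfolded v]
    have "u ^ 3 * (a * (- 3 * w + c * (m ^ 3 * U\<^sup>2) - 6 * (m\<^sup>2 * U))
        + 3 * b * (m * w + 3 * c * (m ^ 3 * U\<^sup>2) - 6 * (m\<^sup>2 * U))) = 0"
      by (simp add: algebra_simps)
    hence "a * (- 3 * w + c * (m ^ 3 * U\<^sup>2) - 6 * (m\<^sup>2 * U))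
        + 3 * b * (m * w + 3 * c * (m ^ 3 * U\<^sup>2) - 6 * (m\<^sup>2 * U)) = 0"
      using pos by simp
    hence "m\<^sup>2 * U * (a * (9 + 3 * c + l * c) - 9 * b * (2 * m - 1 - l * c)) = 0"
      using cw lU c(2) unfolding w_def by algebra
    thus ?thesis using m U by simp
  qed
  show thesis
    by (rule that[of m l]) (use m l rel 1 2 3 4 5 6 in \<open>simp_all add: c(2) U_def\<close>)
qed

text \<open>With D and N as named in the proof, the three ratios are p3/p1 = m N / (c^2 D), y3/y1 =
  c^2 / (9m) and b/a = N / (9D). The first times the second is the third, which makes p y / x
  invariant.\<close>

lemma curve_invariance:
  fixes u v y1 y3 a b m l :: real
  assumes a: "a > 0" and ml: "m > 1" "l > 0" "l * (3 - l) * m = (m - 1)\<^sup>2"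
    "u ^ 5 = (3 - l) / (m * (m - 1))" "1 / u ^ 5 = l * m\<^sup>2 / (m - 1)"
    "v ^ 5 = m\<^sup>2 * (3 - l) ^ 3 / (m - 1) ^ 3" "1 / v ^ 5 = m * l ^ 3 / (m - 1) ^ 3"
    and y: "9 * m * y3 = (m - 1)\<^sup>2 * y1"
    and ab: "9 * b * (2 * m - 1 - l * (m - 1)) = a * (9 + 3 * (m - 1) + l * (m - 1))"
  shows "2 * m - 1 - l * (m - 1) \<noteq> 0"
    and "(m - 1)\<^sup>2 * (2 * m - 1 - l * (m - 1)) * (1 / v ^ 5 - 11 - v ^ 5)
       = m * (9 + 3 * (m - 1) + l * (m - 1)) * (1 / u ^ 5 - 11 - u ^ 5)"
    and "(1 / v ^ 5 - 11 - v ^ 5) * y3 * a = (1 / u ^ 5 - 11 - u ^ 5) * y1 * b"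
proof -
  define c D N p1 p3 where "c = m - 1" and "D = 2 * m - 1 - l * (m - 1)" and "N = 9 + 3 * (m - 1) + l * (m - 1)"
    and "p1 = 1 / u ^ 5 - 11 - u ^ 5" and "p3 = 1 / v ^ 5 - 11 - v ^ 5"
  have c: "c > 0" using ml by (simp add: c_def)
  have N: "N > 0" using ml by (auto simp: N_def intro!: add_pos_pos mult_pos_pos)
  have ab': "9 * b * D = a * N" using ab by (simp add: D_def N_def)
  show D: "2 * m - 1 - l * (m - 1) \<noteq> 0"
    using ab' a N by (auto simp: D_def)
  have A1: "m * c * p1 = l * m ^ 3 - (3 - l) - 11 * m * c"
    unfolding p1_def ml(5) unfolding ml(4) c_def[symmetric] using ml(1) c by (intro clear_curve_denoms) auto
  have A3: "c ^ 3 * p3 = m * l ^ 3 - m\<^sup>2 * (3 - l) ^ 3 - 11 * c ^ 3"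
    unfolding p3_def ml(7) unfolding ml(6) c_def[symmetric] using c by (simp add: field_simps)
  have "D * (c ^ 3 * p3) = N * (m * c * p1)"
    unfolding A1 A3 using curve_id1[OF ml(3)] by (simp add: c_def D_def N_def)
  hence "c * (c\<^sup>2 * D * p3) = c * (m * N * p1)" by (simp add: power2_eq_square power3_eq_cube mult_ac)
  hence main: "c\<^sup>2 * D * p3 = m * N * p1" using c by simp
  thus "(m - 1)\<^sup>2 * (2 * m - 1 - l * (m - 1)) * (1 / v ^ 5 - 11 - v ^ 5)
       = m * (9 + 3 * (m - 1) + l * (m - 1)) * (1 / u ^ 5 - 11 - u ^ 5)"
    by (simp add: c_def D_def N_def p1_def p3_def)
  have "9 * m * D * (p3 * y3 * a) = (c\<^sup>2 * D * p3) * y1 * a"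
    using y by (simp add: c_def)
  also have "\<dots> = m * (a * N) * p1 * y1" unfolding main by simp
  also have "\<dots> = 9 * m * D * (p1 * y1 * b)" unfolding ab'[symmetric] by simp
  finally show "p3 * y3 * a = p1 * y1 * b" unfolding p1_def p3_def using D ml(1) by (simp add: D_def)
qed

lemma curve_degree_3:
  fixes p1 p3 m l s :: real
  assumes ml: "m > 1" "l * (3 - l) * m = (m - 1)\<^sup>2"
    and p1: "p1 = l * m\<^sup>2 / (m - 1) - 11 - (3 - l) / (m * (m - 1))" "p1 > 0"
    and D: "2 * m - 1 - l * (m - 1) \<noteq> 0"
    and p3: "(m - 1)\<^sup>2 * (2 * m - 1 - l * (m - 1)) * p3 = m * (9 + 3 * (m - 1) + l * (m - 1)) * p1"
    and s: "s > 1" "p3 = p1 * s\<^sup>2"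
  shows "s\<^sup>2 - 1 / s\<^sup>2 = p1 * s + 125 / (p1 * s) + 9 * (s + 1 / s)"
proof -
  define c N H B X Y where "c = m - 1" and "N = 9 + 3 * (m - 1) + l * (m - 1)" and "H = m\<^sup>2 + 7 * m + 1"
    and "B = l * (m + 1) + 1 - 4 * m" and "X = (m - 1) * (l * (m + 1) + 1 - 4 * m)"
    and "Y = m ^ 4 + 2 * m ^ 3 + 15 * m\<^sup>2 - 10 * m + 1 - 4 * l * m * (m\<^sup>2 - 1)"
  define D where "D = 2 * m - 1 - l * (m - 1)"
  have c: "c > 0" using ml by (simp add: c_def)
  have H: "H > 0" using ml by (simp add: H_def add_pos_pos)
  have X_eq: "X = c * B" by (simp add: X_def c_def B_def)
  have D0: "D \<noteq> 0" using D by (simp add: D_def)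
  have tau: "c\<^sup>2 * D * s\<^sup>2 = m * N"
  proof -
    have "p1 * (c\<^sup>2 * D * s\<^sup>2) = p1 * (m * N)"
      using p3 unfolding s(2) c_def D_def N_def by (simp add: mult_ac)
    thus ?thesis using p1(2) by simp
  qed
  have id2: "H\<^sup>2 * D = m * N * B\<^sup>2"
    using curve_id2[OF ml(2)] by (simp add: H_def D_def N_def B_def)
  have B: "B \<noteq> 0" using id2 H D0 by auto
  have X: "X \<noteq> 0" using B c by (simp add: X_eq)
  define t where "t = H / X"
  have t0: "t \<noteq> 0" using H X by (simp add: t_def)
  \<comment> \<open>Both sides equal m N B^2 D, by \<open>tau\<close> and \<open>id2\<close>; hence
    H / X is a square root of p3 / p1.\<close>
  have "D * (X\<^sup>2 * s\<^sup>2) = D * H\<^sup>2"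
    using id2 tau by (simp add: X_eq power_mult_distrib mult_ac)
  hence "X\<^sup>2 * s\<^sup>2 = H\<^sup>2" using D0 by simp
  hence ts: "t\<^sup>2 = s\<^sup>2" using X by (simp add: t_def power_divide field_simps)
  have "m * c * p1 = l * m ^ 3 - (3 - l) - 11 * m * c"
    unfolding p1 c_def[symmetric] using ml(1) c by (intro clear_curve_denoms) auto
  hence "m * c * p1 * H = Y * B"
    using curve_id3[OF ml(2)] by (simp add: c_def H_def Y_def B_def)
  hence y: "p1 * t = Y / (m * c\<^sup>2)"
    using ml(1) c B by (simp add: t_def X_eq field_simps power2_eq_square)
  have Y: "Y \<noteq> 0" using y p1(2) t0 by auto
  have id4: "(H\<^sup>2 - 9 * H * X - X\<^sup>2) * (H\<^sup>2 + X\<^sup>2) * Y * m * c\<^sup>2 = H\<^sup>2 * X\<^sup>2 * (Y\<^sup>2 + 125 * m\<^sup>2 * c ^ 4)"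
    using curve_id4[OF ml(2)] by (simp add: H_def X_def Y_def c_def)
  have "(t - 1 / t - 9) * (t + 1 / t) = p1 * t + 125 / (p1 * t)"
  proof -
    have "(t - 1 / t - 9) * (t + 1 / t) = (H\<^sup>2 - 9 * H * X - X\<^sup>2) * (H\<^sup>2 + X\<^sup>2) / (H\<^sup>2 * X\<^sup>2)"
      using H X by (simp add: t_def field_simps power2_eq_square)
    moreover have "p1 * t + 125 / (p1 * t) = (Y\<^sup>2 + 125 * m\<^sup>2 * c ^ 4) / (Y * m * c\<^sup>2)"
      unfolding y using Y c ml(1) by (simp add: field_simps eval_nat_numeral)
    moreover have "(H\<^sup>2 - 9 * H * X - X\<^sup>2) * (H\<^sup>2 + X\<^sup>2) / (H\<^sup>2 * X\<^sup>2) = (Y\<^sup>2 + 125 * m\<^sup>2 * c ^ 4) / (Y * m * c\<^sup>2)"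
      using id4 H X Y c ml(1) by (simp add: frac_eq_eq mult_ac)
    ultimately show ?thesis by simp
  qed
  moreover have "(t - 1 / t - 9) * (t + 1 / t) = t\<^sup>2 - 1 / t\<^sup>2 - 9 * (t + 1 / t)"
    using t0 by (simp add: field_simps power2_eq_square)
  ultimately have main: "t\<^sup>2 - 1 / t\<^sup>2 = p1 * t + 125 / (p1 * t) + 9 * (t + 1 / t)" by simp
  \<comment> \<open>The left side of \<open>main\<close> is even in \<open>t\<close> and the right
    side odd. For \<open>t = - s\<close> a positive number would equal a negative one, since
    \<open>s > 1\<close> and \<open>p1 > 0\<close>.\<close>
  have "t = s"
  proof (rule ccontr)
    assume "t \<noteq> s"
    hence t: "t = - s" using ts by (simp add: power2_eq_iff)
    have "s\<^sup>2 - 1 / s\<^sup>2 > 0"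
    proof -
      have "1 < s\<^sup>2" using s by (simp add: one_less_power)
      moreover have "1 / s\<^sup>2 < 1" using calculation by (subst divide_less_eq_1_pos) auto
      ultimately show ?thesis by simp
    qed
    moreover have "p1 * s + 125 / (p1 * s) + 9 * (s + 1 / s) > 0"
      using p1(2) s by (intro add_pos_pos mult_pos_pos divide_pos_pos) auto
    moreover have "s\<^sup>2 - 1 / s\<^sup>2 = - (p1 * s + 125 / (p1 * s) + 9 * (s + 1 / s))"
      using main unfolding t by simp
    ultimately show False by simp
  qed
  thus ?thesis using main by simp
qed

text \<open>The quotient \<open>r\<close> of the two sides is unchanged under x -> x^3, so it equals
  its values along q^(3^k), which tends to 0. The limit sees only the leading term 1 / R^5; the
  constant 11 is forced by the curve identities.\<close>

lemma rr_fifth_power: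
  assumes q: "0 < q" "q < 1"
  defines "u \<equiv> rogers_ramanujan_cf q"
  shows "1 / u ^ 5 - 11 - u ^ 5 = rr_x q / rr_y q"
proof -
  define r where "r = (\<lambda>x. (1 / rogers_ramanujan_cf x ^ 5 - 11 - rogers_ramanujan_cf x ^ 5) * rr_y x / rr_x x)"
  have step: "r (x ^ 3) = r x" if x: "0 < x" "x < 1" for x
  proof -
    have x3: "0 < x ^ 3" "x ^ 3 < 1" using x by (simp_all add: power_less_one_iff)
    note pos = rr_xy_pos[OF x] rr_xy_pos[OF x3]
    obtain m l where ml: "m > 1" "l > 0" "l * (3 - l) * m = (m - 1)\<^sup>2"
      "rogers_ramanujan_cf x ^ 5 = (3 - l) / (m * (m - 1))" "1 / rogers_ramanujan_cf x ^ 5 = l * m\<^sup>2 / (m - 1)"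
      "rogers_ramanujan_cf (x ^ 3) ^ 5 = m\<^sup>2 * (3 - l) ^ 3 / (m - 1) ^ 3"
      "1 / rogers_ramanujan_cf (x ^ 3) ^ 5 = m * l ^ 3 / (m - 1) ^ 3"
      "9 * m * rr_y (x ^ 3) = (m - 1)\<^sup>2 * rr_y x"
      "9 * rr_x (x ^ 3) * (2 * m - 1 - l * (m - 1)) = rr_x x * (9 + 3 * (m - 1) + l * (m - 1))"
      by (rule curve_parameters[OF rogers_ramanujan_cf_pos[OF x] rr_cubic_factors(3)[OF x]
            rr_cubic_factors(1,2)[OF x] rr_derivative_relation[OF x]])
    have "(1 / rogers_ramanujan_cf (x ^ 3) ^ 5 - 11 - rogers_ramanujan_cf (x ^ 3) ^ 5) * rr_y (x ^ 3) * rr_x x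
        = (1 / rogers_ramanujan_cf x ^ 5 - 11 - rogers_ramanujan_cf x ^ 5) * rr_y x * rr_x (x ^ 3)"
      by (rule curve_invariance(3)[OF pos(1) ml])
    thus ?thesis unfolding r_def using pos by (simp add: frac_eq_eq)
  qed
  have iter: "r (q ^ (3 ^ k)) = r q" for k
  proof (induction k)
    case (Suc k)
    have "q ^ 3 ^ Suc k = (q ^ 3 ^ k) ^ 3" by (simp add: mult.commute flip: power_mult)
    moreover have "0 < q ^ 3 ^ k" "q ^ 3 ^ k < 1" using q by (simp_all add: power_less_one_iff)
    ultimately show ?case using step[of "q ^ 3 ^ k"] Suc by simp
  qed simp
  have lim: "(r \<longlongrightarrow> 1) (at_right 0)"
  proof -
    \<comment> \<open>The form of \<open>r\<close> in which q^(1/5) and the pole of 1 / R^5 have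
      cancelled against the factor x of \<open>rr_y\<close>, so the limit can be taken factor by
      factor.\<close>
    define g where "g = (\<lambda>x. ((th2 x / th1 x) ^ 5 - 11 * x - x\<^sup>2 * (th1 x / th2 x) ^ 5) * euler_f (x ^ 5) ^ 6 / euler_f x ^ 6)"
    have ev: "\<forall>\<^sub>F x::real in at_right 0. x \<in> {0<..<1}"
      by (rule eventually_at_right_real) auto
    have e1: "(euler_f \<longlongrightarrow> 1) (at_right 0)"
      using tendsto_qpoch_at_right_0[of 1 1] by (simp add: euler_f_def[abs_def])
    have e5: "((\<lambda>x. euler_f (x ^ 5)) \<longlongrightarrow> 1) (at_right 0)"
      using tendsto_qpoch_at_right_0[of 5 5] by (simp add: euler_f_def)
    have t1: "(th1 \<longlongrightarrow> 1) (at_right 0)"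
    proof (rule Lim_transform_eventually)
      show "((\<lambda>x. qpoch (x ^ 1) (x ^ 5) * qpoch (x ^ 4) (x ^ 5)) \<longlongrightarrow> (1 :: real)) (at_right 0)"
        using tendsto_mult[OF tendsto_qpoch_at_right_0[of 1 5] tendsto_qpoch_at_right_0[of 4 5]] by simp
      show "\<forall>\<^sub>F x in at_right 0. qpoch (x ^ 1) (x ^ 5) * qpoch (x ^ 4) (x ^ 5) = th1 x"
        using ev by eventually_elim (simp add: rr_theta_eq)
    qed
    have t2: "(th2 \<longlongrightarrow> 1) (at_right 0)"
    proof (rule Lim_transform_eventually)
      show "((\<lambda>x. qpoch (x ^ 2) (x ^ 5) * qpoch (x ^ 3) (x ^ 5)) \<longlongrightarrow> (1 :: real)) (at_right 0)"
        using tendsto_mult[OF tendsto_qpoch_at_right_0[of 2 5] tendsto_qpoch_at_right_0[of 3 5]] by simp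
      show "\<forall>\<^sub>F x in at_right 0. qpoch (x ^ 2) (x ^ 5) * qpoch (x ^ 3) (x ^ 5) = th2 x"
        using ev by eventually_elim (simp add: rr_theta_eq)
    qed
    have "(g \<longlongrightarrow> ((1 / 1) ^ 5 - 11 * 0 - 0\<^sup>2 * (1 / 1) ^ 5) * 1 ^ 6 / 1 ^ 6) (at_right 0)"
      unfolding g_def by (intro tendsto_intros e1 e5 t1 t2) auto
    moreover have "\<forall>\<^sub>F x in at_right 0. g x = r x"
      using ev
    proof eventually_elim
      case (elim x)
      hence x: "0 < x" "x < 1" by auto
      have R5: "rogers_ramanujan_cf x ^ 5 = x * (th1 x / th2 x) ^ 5"
        unfolding rogers_ramanujan_cf_eq_theta[OF x] power_mult_distrib using x by (simp add: powr_power)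
      have "euler_f (x ^ 5) > 0" using x by (intro rr_theta_pos) (auto simp: power_less_one_iff)
      thus "g x = r x"
        unfolding r_def R5 g_def rr_x_def rr_y_def using x rr_theta_pos[OF x]
        by (simp add: field_simps eval_nat_numeral)
    qed
    ultimately have "(r \<longlongrightarrow> ((1 / 1) ^ 5 - 11 * 0 - 0\<^sup>2 * (1 / 1) ^ 5) * 1 ^ 6 / 1 ^ 6) (at_right 0)"
      by (rule Lim_transform_eventually)
    thus ?thesis by simp
  qed
  have "(\<lambda>k. q ^ (3 ^ k)) \<longlonglongrightarrow> 0"
  proof (rule LIMSEQ_subseq_LIMSEQ[of "\<lambda>n. q ^ n", unfolded o_def])
    show "(\<lambda>n. q ^ n) \<longlonglongrightarrow> 0" using q by (intro LIMSEQ_power_zero) auto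
    show "strict_mono (\<lambda>k. 3 ^ k :: nat)" by (simp add: strict_mono_def)
  qed
  hence "filterlim (\<lambda>k. q ^ (3 ^ k)) (at_right 0) sequentially"
    using q by (auto simp: filterlim_at)
  from filterlim_compose[OF lim this] have "(\<lambda>k. r q) \<longlonglongrightarrow> 1"
    by (simp add: iter)
  hence "r q = 1" using LIMSEQ_unique[OF tendsto_const] by metis
  thus ?thesis using rr_xy_pos[OF q] by (simp add: r_def u_def field_simps)
qed

section \<open>Passage from the continued fraction to N\<close>

lemma euler_f_eq_ramanujan_f: "euler_f q = ramanujan_f (- q)"
  by (simp add: euler_f_def qpoch_def ramanujan_f_def)

lemma rr_N_eq:
  assumes q: "0 < q" "q < 1"
  shows "5 * rr_N q = q powr (- 1 / 6) * (th1 q * th2 q)"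
proof -
  have "deriv rogers_ramanujan_cf q = rogers_ramanujan_cf q * rr_x q / (5 * q)"
    by (rule DERIV_imp_deriv[OF has_real_derivative_rogers_ramanujan_cf[OF q]])
  hence "deriv rogers_ramanujan_cf q / rogers_ramanujan_cf q = rr_x q / (5 * q)"
    using rogers_ramanujan_cf_pos[OF q] by simp
  hence "5 * rr_N q = q powr (5 / 6) / q * (rr_x q / euler_f q ^ 4)"
    by (simp add: rr_N_def power_int_minus field_simps flip: euler_f_eq_ramanujan_f)
  also have "q powr (5 / 6) / q = q powr (5 / 6 - 1)"
    using q by (subst powr_diff) simp
  also have "rr_x q / euler_f q ^ 4 = th1 q * th2 q"
    using rr_theta_pos[OF q] by (simp add: rr_theta_mult[OF q] rr_x_def field_simps eval_nat_numeral)
  finally show ?thesis by simp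
qed

lemma rr_N_power6:
  assumes q: "0 < q" "q < 1"
  shows "(5 * rr_N q) ^ 6 = rr_x q / rr_y q"
proof -
  have "(q powr (- 1 / 6)) ^ 6 = 1 / q"
    using q by (simp add: powr_power powr_minus field_simps)
  hence "(5 * rr_N q) ^ 6 = 1 / q * (euler_f q ^ 6 / euler_f (q ^ 5) ^ 6)"
    unfolding rr_N_eq[OF q] rr_theta_mult[OF q] power_mult_distrib power_divide by (simp only:)
  also have "\<dots> = rr_x q / rr_y q"
    unfolding rr_x_def rr_y_def using q rr_theta_pos[OF q] by (simp add: field_simps flip: power_Suc power_Suc2 power_add)
  finally show ?thesis .
qed

theorem mainTheorem3:
  fixes q u v :: real
  assumes "q \<in> {0<..<1}"
    and "u = rr_N q"
    and "v = rr_N (q ^ 3)"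
  shows "125 * u ^ 12 + u ^ 3 * v ^ 3 + 1125 * u ^ 9 * v ^ 3 + 1125 * u ^ 3 * v ^ 9
           + 1953125 * u ^ 9 * v ^ 9 - 125 * v ^ 12 = 0"
proof -
  have q: "0 < q" "q < 1" using assms by auto
  have q3: "0 < q ^ 3" "q ^ 3 < 1" using q by (simp_all add: power_less_one_iff)
  define P Q where "P = 5 * u" and "Q = 5 * v"
  have P: "P = q powr (- 1 / 6) * (th1 q * th2 q)" and Q: "Q = (q ^ 3) powr (- 1 / 6) * (th1 (q ^ 3) * th2 (q ^ 3))"
    using rr_N_eq[OF q] rr_N_eq[OF q3] assms by (simp_all add: P_def Q_def)
  have P0: "P > 0" unfolding P using q rr_theta_pos[OF q] by simp
  have "q ^ 3 < q" using q power_strict_decreasing[of 1 3 q] by simp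
  hence "q powr (- 1 / 6) < (q ^ 3) powr (- 1 / 6)"
    using q q3 by (intro powr_less_mono2_neg) auto
  hence PQ: "P < Q"
    unfolding P Q using rr_theta_mono[OF q] rr_theta_pos[OF q] by (intro mult_less_le_imp_less) auto
  \<comment> \<open>The positive square root of p3 / p1 = (Q / P)^6.\<close>
  define s where "s = (Q / P) ^ 3"
  have s: "s > 1" unfolding s_def using P0 PQ by (intro one_less_power) auto
  define p1 p3 where "p1 = P ^ 6" and "p3 = Q ^ 6"
  note pos = rr_xy_pos[OF q] rr_xy_pos[OF q3]
  have p: "1 / rogers_ramanujan_cf q ^ 5 - 11 - rogers_ramanujan_cf q ^ 5 = p1"
    "1 / rogers_ramanujan_cf (q ^ 3) ^ 5 - 11 - rogers_ramanujan_cf (q ^ 3) ^ 5 = p3"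
    using rr_fifth_power[OF q] rr_fifth_power[OF q3] rr_N_power6[OF q] rr_N_power6[OF q3] assms
    by (simp_all add: p1_def p3_def P_def Q_def)
  obtain m l where ml: "m > 1" "l > 0" "l * (3 - l) * m = (m - 1)\<^sup>2"
      "rogers_ramanujan_cf q ^ 5 = (3 - l) / (m * (m - 1))" "1 / rogers_ramanujan_cf q ^ 5 = l * m\<^sup>2 / (m - 1)"
      "rogers_ramanujan_cf (q ^ 3) ^ 5 = m\<^sup>2 * (3 - l) ^ 3 / (m - 1) ^ 3"
      "1 / rogers_ramanujan_cf (q ^ 3) ^ 5 = m * l ^ 3 / (m - 1) ^ 3"
      "9 * m * rr_y (q ^ 3) = (m - 1)\<^sup>2 * rr_y q"
      "9 * rr_x (q ^ 3) * (2 * m - 1 - l * (m - 1)) = rr_x q * (9 + 3 * (m - 1) + l * (m - 1))"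
    by (rule curve_parameters[OF rogers_ramanujan_cf_pos[OF q] rr_cubic_factors(3)[OF q]
          rr_cubic_factors(1,2)[OF q] rr_derivative_relation[OF q]])
  have "s\<^sup>2 - 1 / s\<^sup>2 = p1 * s + 125 / (p1 * s) + 9 * (s + 1 / s)"
  proof (rule curve_degree_3[OF ml(1,3)])
    show "p1 = l * m\<^sup>2 / (m - 1) - 11 - (3 - l) / (m * (m - 1))"
      using p(1) unfolding ml(5) unfolding ml(4) by simp
    show "2 * m - 1 - l * (m - 1) \<noteq> 0"
      by (rule curve_invariance(1)[OF pos(1) ml])
    show "(m - 1)\<^sup>2 * (2 * m - 1 - l * (m - 1)) * p3 = m * (9 + 3 * (m - 1) + l * (m - 1)) * p1"
      using curve_invariance(2)[OF pos(1) ml] unfolding p .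
    show "p3 = p1 * s\<^sup>2"
      using P0 by (simp add: p1_def p3_def s_def power_divide flip: power_mult)
  qed (use P0 s in \<open>auto simp: p1_def\<close>)
  \<comment> \<open>Here s = y / x and p1 s = x y, so clearing denominators gives a polynomial
    equation in the cubes of P and Q.\<close>
  moreover define x y where "x = P ^ 3" and "y = Q ^ 3"
  have xy: "x > 0" "y > 0" using P0 PQ by (simp_all add: x_def y_def)
  moreover have "s = y / x" by (simp add: s_def x_def y_def power_divide)
  moreover have "p1 = x\<^sup>2" by (simp add: p1_def x_def flip: power_mult)
  ultimately have "(y / x)\<^sup>2 - (x / y)\<^sup>2 = x * y + 125 / (x * y) + 9 * (y / x + x / y)"
    by (simp add: power2_eq_square)
  moreover have "(y / x) * x = y" "(x / y) * y = x" "125 / (x * y) * (x * y) = 125"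
    using xy by simp_all
  ultimately have "y ^ 4 - x ^ 4 = x ^ 3 * y ^ 3 + 125 * x * y + 9 * (x * y ^ 3 + x ^ 3 * y)"
    by algebra
  \<comment> \<open>The cube of 5 enters from P = 5u and Q = 5v. After division by 125^3 the
    coefficients become 1125 = 9 * 125 and 1953125 = 125^3.\<close>
  moreover have "x = 125 * u ^ 3" "y = 125 * v ^ 3"
    by (simp_all add: x_def y_def P_def Q_def power_mult_distrib)
  ultimately have "125 * (u ^ 3) ^ 4 + u ^ 3 * v ^ 3 + 1125 * (u ^ 3) ^ 3 * v ^ 3 + 1125 * u ^ 3 * (v ^ 3) ^ 3
           + 1953125 * (u ^ 3) ^ 3 * (v ^ 3) ^ 3 - 125 * (v ^ 3) ^ 4 = 0"
    by (simp add: power_mult_distrib)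
  thus ?thesis by (simp flip: power_mult)
qed

end
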